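(* Let $PG$ be the Petersen graph and let $f:PG\to\mathbb{R}^{3}$ be a Legendrian embedding. Then \[ TB_{6}(f)=TB_{5}(f),\qquad TB_{8}(f)=2\,TB_{5}(f),\qquad TB_{9}(f)=3\,TB_{5}(f). \] Therefore \[ TB(f)=7\,TB_{5}(f). \]
   Context: The Petersen graph $PG$ has vertices $u_i,v_i$ ($i\in\mathbb{Z}/5\mathbb{Z}$) and the $15$ edges $u_iu_{i+1}$, $u_iv_i$, $v_iv_{i+2}$. $\mathbb{R}^3$ carries the standard contact structure $\xi_{\rm std}$. A Legendrian embedding of a finite graph $G$ is an embedding $f:G\to\mathbb{R}^3$ whose edges are everywhere tangent to the contact planes (with, at each vertex, the outgoing tangent directions of the incident edges pairwise distinct); each cycle is then mapped to a (piecewise smooth) Legendrian knot, whose Thurston–Bennequin number $\mathrm{tb}$ is defined as usual (after Legendrian smoothing at the vertices). A $k$-cycle is a subgraph with $k$ edges homeomorphic to a circle; $\Gamma(G)$ and $\Gamma_k(G)$ denote the sets of all cycles and of all $k$-cycles of $G$. Define \[ TB(f)=\sum_{\gamma\in\Gamma(G)}\mathrm{tb}(f(\gamma)),\qquad TB_{k}(f)=\sum_{\gamma\in\Gamma_{k}(G)}\mathrm{tb}(f(\gamma)). \] *)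

theory Defs
  imports "HOL-Analysis.Analysis" "HOL-Analysis.Cross3"
begin

section \<open>The Petersen graph and cycles in graphs\<close>

text \<open>A graph is given by its vertex set and its edge set, edges being two-element sets of
  vertices. The numeral type 5 is the ring of integers modulo 5.\<close>

datatype petersen_vertex = PG_u "5" | PG_v "5"

definition petersen_edges :: "petersen_vertex set set" where
  "petersen_edges =
     {{PG_u i, PG_u (i + 1)} | i. True} \<union> {{PG_u i, PG_v i} | i. True} \<union>
     {{PG_v i, PG_v (i + 2)} | i. True}"

text \<open>A subgraph homeomorphic to a circle is identified with its edge set. It is traced by a
  cyclic sequence of distinct vertices, unique up to rotation and reversal.\<close>

definition traces_cycle :: "'v set set \<Rightarrow> 'v list \<Rightarrow> 'v set set \<Rightarrow> bool" where
  "traces_cycle E vs \<gamma> \<longleftrightarrow>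
     3 \<le> length vs \<and> distinct vs \<and> \<gamma> \<subseteq> E \<and>
     \<gamma> = {{vs ! i, vs ! (Suc i mod length vs)} | i. i < length vs}"

definition cycles :: "'v set set \<Rightarrow> 'v set set set" where
  "cycles E = {\<gamma>. \<exists>vs. traces_cycle E vs \<gamma>}"

definition k_cycles :: "nat \<Rightarrow> 'v set set \<Rightarrow> 'v set set set" where
  "k_cycles k E = {\<gamma> \<in> cycles E. card \<gamma> = k}"

section \<open>Legendrian curves and Legendrian embeddings of graphs\<close>

text \<open>Smooth means infinitely differentiable, one-sidedly at the end points of an interval;
  \<open>D n\<close> is the n-th derivative.\<close>

definition smooth_curve_on :: "real set \<Rightarrow> (real \<Rightarrow> real^3) \<Rightarrow> bool" where
  "smooth_curve_on S g \<longleftrightarrow>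
     (\<exists>D :: nat \<Rightarrow> real \<Rightarrow> real^3. (\<forall>t\<in>S. D 0 t = g t) \<and>
        (\<forall>n. \<forall>t\<in>S. (D n has_vector_derivative D (Suc n) t) (at t within S)))"

text \<open>The plane at \<open>q = (x, y, z)\<close> of the standard contact structure, the kernel of
  \<open>dz - y dx\<close>.\<close>

definition xi_std :: "real^3 \<Rightarrow> (real^3) set" where
  "xi_std q = {w. w $ 3 - q $ 2 * w $ 1 = 0}"

definition legendrian_curve_on :: "real set \<Rightarrow> (real \<Rightarrow> real^3) \<Rightarrow> bool" where
  "legendrian_curve_on S g \<longleftrightarrow> smooth_curve_on S g \<and>
     (\<forall>t\<in>S. vector_derivative g (at t within S) \<noteq> 0 \<and>
            vector_derivative g (at t within S) \<in> xi_std (g t))"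

text \<open>A map from a graph to space is given by the images \<open>p a\<close> of the vertices and, for every
  edge \<open>{a, b}\<close>, by its parametrisation \<open>e a b\<close> from \<open>a\<close> to \<open>b\<close> over the unit interval;
  \<open>e b a\<close> is the same arc run backwards. On pairs that are not edges \<open>e\<close> is irrelevant.
  The conditions on open arcs and vertices together say that the map is injective on the
  geometric realisation of the graph. The last condition compares outgoing directions as rays.\<close>

definition legendrian_embedding ::
    "'v set \<Rightarrow> 'v set set \<Rightarrow> ('v \<Rightarrow> real^3) \<Rightarrow> ('v \<Rightarrow> 'v \<Rightarrow> real \<Rightarrow> real^3) \<Rightarrow> bool" where
  "legendrian_embedding V E p e \<longleftrightarrow>
     (\<forall>a b. {a, b} \<in> E \<longrightarrow>
        e a b 0 = p a \<and> e a b 1 = p b \<and> (\<forall>t\<in>{0..1}. e b a t = e a b (1 - t)) \<and>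
        legendrian_curve_on {0..1} (e a b)) \<and>
     inj_on p V \<and>
     (\<forall>a b. {a, b} \<in> E \<longrightarrow>
        inj_on (e a b) {0<..<1} \<and> p ` V \<inter> e a b ` {0<..<1} = {}) \<and>
     (\<forall>a b c d. {a, b} \<in> E \<longrightarrow> {c, d} \<in> E \<longrightarrow> {a, b} \<noteq> {c, d} \<longrightarrow>
        e a b ` {0<..<1} \<inter> e c d ` {0<..<1} = {}) \<and>
     (\<forall>a b c. {a, b} \<in> E \<longrightarrow> {a, c} \<in> E \<longrightarrow> b \<noteq> c \<longrightarrow>
        sgn (vector_derivative (e a b) (at 0 within {0..1})) \<noteq>
        sgn (vector_derivative (e a c) (at 0 within {0..1})))"

text \<open>The closed curve, of period \<open>length vs\<close>, that runs through the arcs of the cycle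
  \<open>vs\<close> in order; it passes the i-th vertex at time \<open>i\<close>.\<close>

definition cycle_curve :: "('v \<Rightarrow> 'v \<Rightarrow> real \<Rightarrow> real^3) \<Rightarrow> 'v list \<Rightarrow> real \<Rightarrow> real^3" where
  "cycle_curve e vs t =
     (let i = nat (\<lfloor>t\<rfloor> mod int (length vs))
      in e (vs ! i) (vs ! (Suc i mod length vs)) (frac t))"

section \<open>The Thurston--Bennequin number\<close>

text \<open>Legendrian knots are parametrised as periodic curves of period \<open>k\<close>.\<close>

definition legendrian_knot :: "nat \<Rightarrow> (real \<Rightarrow> real^3) \<Rightarrow> bool" where
  "legendrian_knot k L \<longleftrightarrow>
     legendrian_curve_on UNIV L \<and> (\<forall>t. L (t + real k) = L t) \<and> inj_on L {0..<real k}"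

text \<open>The Gauss linking integral of two disjoint closed curves of period \<open>k\<close>.\<close>

definition linking_number :: "nat \<Rightarrow> (real \<Rightarrow> real^3) \<Rightarrow> (real \<Rightarrow> real^3) \<Rightarrow> real" where
  "linking_number k A B =
     1 / (4 * pi) *
     integral {0..real k} (\<lambda>t. integral {0..real k} (\<lambda>s.
       ((A t - B s) \<bullet> cross3 (vector_derivative A (at t)) (vector_derivative B (at s)))
         / norm (A t - B s) ^ 3))"

text \<open>The linking number of a Legendrian knot with its push-off in the direction of the
  \<open>z\<close>-axis, which is transverse to the contact planes. It is the same for all sufficiently small
  push-offs.\<close>

definition tb :: "nat \<Rightarrow> (real \<Rightarrow> real^3) \<Rightarrow> real" where
  "tb k L = (THE x. \<forall>\<^sub>F \<epsilon> in at_right 0.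
     linking_number k L (\<lambda>t. L t + \<epsilon> *\<^sub>R axis 3 1) = x)"

text \<open>\<open>L\<close> is a Legendrian smoothing of the piecewise smooth Legendrian closed curve \<open>K\<close> of period
  \<open>k\<close> whose corners are at the integers. The two curves agree outside disjoint balls around the
  corners, and each ball meets \<open>K\<close> only in an arc \<open>K ` {a<..<b}\<close> through its centre. In the
  ball \<open>L\<close> rounds the corner without additional turns: there is a horizontal direction \<open>w\<close> in
  which both curves move strictly forward, so that both arcs are graphs over the line spanned by
  \<open>w\<close>. This rules out adding zigzags, which would change the Thurston--Bennequin number. Such a
  \<open>w\<close> exists for small balls because the two outgoing directions at a corner differ.\<close>

definition legendrian_smoothing :: "nat \<Rightarrow> (real \<Rightarrow> real^3) \<Rightarrow> (real \<Rightarrow> real^3) \<Rightarrow> bool" where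
  "legendrian_smoothing k K L \<longleftrightarrow>
     legendrian_knot k L \<and>
     (\<exists>r>0.
       (\<forall>i<k. \<forall>j<k. i \<noteq> j \<longrightarrow> ball (K (real i)) r \<inter> ball (K (real j)) r = {}) \<and>
       (\<forall>t. (\<forall>i<k. K t \<notin> ball (K (real i)) r) \<longrightarrow> L t = K t) \<and>
       (\<forall>i<k. \<exists>a b w. real i - 1 < a \<and> a < real i \<and> real i < b \<and> b < real i + 1 \<and> w $ 3 = 0 \<and>
          (\<forall>t\<in>{real i - real k / 2..real i + real k / 2}.
             K t \<in> ball (K (real i)) r \<longleftrightarrow> t \<in> {a<..<b}) \<and>
          (\<forall>t\<in>{a<..<b}. L t \<in> ball (K (real i)) r \<and>
             0 < w \<bullet> vector_derivative L (at t) \<and>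
             (t \<noteq> real i \<longrightarrow> 0 < w \<bullet> vector_derivative K (at t)))))"

definition smoothing_of_cycle ::
    "'v set set \<Rightarrow> ('v \<Rightarrow> 'v \<Rightarrow> real \<Rightarrow> real^3) \<Rightarrow> 'v set set \<Rightarrow> (real \<Rightarrow> real^3) \<Rightarrow> bool" where
  "smoothing_of_cycle E e \<gamma> L \<longleftrightarrow>
     (\<exists>vs. traces_cycle E vs \<gamma> \<and> legendrian_smoothing (length vs) (cycle_curve e vs) L)"

text \<open>Here \<open>S \<gamma>\<close> is a Legendrian smoothing, of period \<open>card \<gamma>\<close>, of the image of the cycle
  \<open>\<gamma>\<close>.\<close>

definition TB_total :: "'v set set \<Rightarrow> ('v set set \<Rightarrow> real \<Rightarrow> real^3) \<Rightarrow> real" where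
  "TB_total E S = (\<Sum>\<gamma>\<in>cycles E. tb (card \<gamma>) (S \<gamma>))"

definition TB :: "nat \<Rightarrow> 'v set set \<Rightarrow> ('v set set \<Rightarrow> real \<Rightarrow> real^3) \<Rightarrow> real" where
  "TB k E S = (\<Sum>\<gamma>\<in>k_cycles k E. tb (card \<gamma>) (S \<gamma>))"

end

theory Submission
  imports Defs
begin

text \<open>The Gauss integral of two edges, the second one pushed off by \<open>\<epsilon>\<close> along the \<open>z\<close>-axis, defines a
  bilinear form on the 1-chains of the graph, and for small \<open>\<epsilon> > 0\<close> the number \<open>tb\<close> of a cycle \<open>\<gamma>\<close> is the
  value of this form on \<open>\<gamma> \<otimes> \<gamma>\<close>. Indeed the straight-line homotopy from the image of the cycle to its
  Legendrian smoothing never has short vertical chords, and the Gauss integral of two closed curves is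
  invariant under homotopies that keep the curves disjoint. The theorem thus reduces to the tensors
  \<open>\<Sum> \<gamma> \<otimes> \<gamma>\<close> over all \<open>k\<close>-cycles of the Petersen graph being proportional for \<open>k = 5, 6, 8, 9\<close>, with
  factors \<open>1, 1, 2, 3\<close>.\<close>

section \<open>The Gauss integral\<close>

text \<open>The Gauss integral is used because it splits over pairs of edges. On a single pair it is
  no invariant and varies with \<epsilon>; only its sum over closed cycles is rigid, so one value of
  \<epsilon> has to serve all cycles at once.

  The obstacle is to connect a cycle with its smoothing. Outside the corner balls the two curves
  coincide; inside, they merely share a horizontal direction in which both advance. This direction
  excludes vertical chords between nearby parameters at every stage of the homotopy, and compactness
  turns the local statement into a uniform bound. The delicate case is a point where two corner
  balls touch: agreement of the curves at one point does not give equal derivatives, and a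
  second-order argument takes over.

  The factors come from symmetry: the cycle space, of dimension 15 - 10 + 1 = 6, is an irreducible
  representation of the automorphism group S_5, so by Schur's lemma the invariant tensors in its
  square form a line.\<close>

definition gauss_form :: "real^3 \<Rightarrow> real^3 \<Rightarrow> real^3 \<Rightarrow> real" where
  "gauss_form q x y = (q \<bullet> cross3 x y) / norm q ^ 3"

definition gauss_form_deriv ::
    "real^3 \<Rightarrow> real^3 \<Rightarrow> real^3 \<Rightarrow> real^3 \<Rightarrow> real^3 \<Rightarrow> real^3 \<Rightarrow> real" where
  "gauss_form_deriv q x y q' x' y' =
     (q' \<bullet> cross3 x y + q \<bullet> cross3 x' y + q \<bullet> cross3 x y') / norm q ^ 3
     - 3 * (q \<bullet> q') * (q \<bullet> cross3 x y) / norm q ^ 5"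

text \<open>The velocities are arguments of their own: edges have one-sided derivatives at their
  ends, reversed arcs have negated ones, and a push-off keeps the velocity of the original
  curve.\<close>

definition gauss_integral ::
    "(real \<Rightarrow> real^3) \<Rightarrow> (real \<Rightarrow> real^3) \<Rightarrow> (real \<Rightarrow> real^3) \<Rightarrow> (real \<Rightarrow> real^3) \<Rightarrow> real" where
  "gauss_integral A A' B B' =
     integral {0..1} (\<lambda>t. integral {0..1} (\<lambda>u. gauss_form (A t - B u) (A' t) (B' u)))"

lemma bounded_bilinear_cross3: "bounded_bilinear cross3"
  using bilinear_cross by (rule bilinear_conv_bounded_bilinear[THEN iffD1])

lemma continuous_on_cross3 [continuous_intros]:
  fixes f g :: "'a::topological_space \<Rightarrow> real^3"
  assumes "continuous_on S f" "continuous_on S g"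
  shows "continuous_on S (\<lambda>x. cross3 (f x) (g x))"
  using assms by (rule bounded_bilinear.continuous_on[OF bounded_bilinear_cross3])

lemma gauss_form_has_derivative:
  fixes q x y :: "real \<Rightarrow> real^3"
  assumes q: "(q has_vector_derivative q') (at t within T)"
    and x: "(x has_vector_derivative x') (at t within T)"
    and y: "(y has_vector_derivative y') (at t within T)"
    and nz: "q t \<noteq> 0"
  shows "((\<lambda>t. gauss_form (q t) (x t) (y t)) has_real_derivative
     gauss_form_deriv (q t) (x t) (y t) q' x' y') (at t within T)"
proof -
  have c: "((\<lambda>t. cross3 (x t) (y t)) has_vector_derivative
      cross3 (x t) y' + cross3 x' (y t)) (at t within T)"
    by (rule bounded_bilinear.has_vector_derivative[OF bounded_bilinear_cross3 x y])
  have n: "((\<lambda>t. q t \<bullet> cross3 (x t) (y t)) has_real_derivative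
      q t \<bullet> (cross3 (x t) y' + cross3 x' (y t)) + q' \<bullet> cross3 (x t) (y t)) (at t within T)"
    unfolding has_real_derivative_iff_has_vector_derivative
    by (rule bounded_bilinear.has_vector_derivative[OF bounded_bilinear_inner q c])
  have "((\<lambda>t. q t \<bullet> q t) has_real_derivative q t \<bullet> q' + q' \<bullet> q t) (at t within T)"
    unfolding has_real_derivative_iff_has_vector_derivative
    by (rule bounded_bilinear.has_vector_derivative[OF bounded_bilinear_inner q q])
  moreover have pos: "0 < q t \<bullet> q t" using nz by simp
  ultimately have "((\<lambda>t. sqrt (q t \<bullet> q t)) has_real_derivative
      (q t \<bullet> q') / norm (q t)) (at t within T)"
    by (auto intro!: derivative_eq_intros simp: inner_commute norm_eq_sqrt_inner field_simps simp del: inner_gt_zero_iff)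
  hence m: "((\<lambda>t. norm (q t)) has_real_derivative (q t \<bullet> q') / norm (q t)) (at t within T)"
    by (simp add: norm_eq_sqrt_inner)
  have "norm (q t) \<noteq> 0" using nz by simp
  thus ?thesis
    unfolding gauss_form_def
    by (auto intro!: derivative_eq_intros n m
        simp: gauss_form_deriv_def divide_simps inner_add_right power_numeral_reduce)
      (simp add: algebra_simps)?
qed

text \<open>The field \<open>q / |q|\<^sup>3\<close> is free of divergence. With \<open>q\<close> the difference of two moving curves, \<open>A, B\<close>
  their velocities and \<open>S, X, Y\<close> the derivatives of \<open>q, A, B\<close> along the homotopy, this turns the
  derivative of the Gauss integrand into a sum of derivatives along the two curves.\<close>

lemma gauss_form_deriv_closed:
  assumes "q \<noteq> 0"
  shows "gauss_form_deriv q A B S X Y =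
    gauss_form_deriv q S B A X 0 + gauss_form_deriv q S A (- B) (- Y) 0"
proof -
  have n: "norm q ^ 2 = q \<bullet> q" by (simp add: power2_norm_eq_inner)
  have nz: "norm q \<noteq> 0" using assms by simp
  \<comment> \<open>Cramer's rule writes \<open>q\<close> in terms of \<open>S\<close>,
    \<open>A\<close>, \<open>B\<close> with determinants as coefficients; this is its inner product
    with \<open>q\<close>. The determinant of \<open>S\<close>, \<open>A\<close>, \<open>B\<close>
    has coefficient 1 on the left of the claim and -2 on the right, and three times this identity
    supplies the difference.\<close>
  have cramer: "(q \<bullet> q) * (S \<bullet> cross3 A B) =
      (q \<bullet> S) * (q \<bullet> cross3 A B) - (q \<bullet> A) * (q \<bullet> cross3 S B) + (q \<bullet> B) * (q \<bullet> cross3 S A)"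
    by (simp add: cross3_def inner_vec_def sum_3; algebra)
  have 1: "A \<bullet> cross3 S B = - (S \<bullet> cross3 A B)" "- B \<bullet> cross3 S A = - (S \<bullet> cross3 A B)"
     "q \<bullet> cross3 (- Y) A = q \<bullet> cross3 A Y"  "cross3 S 0 = 0"
    by (simp_all add: cross3_def inner_vec_def sum_3 vec_eq_iff forall_3 algebra_simps)
  define N where "N = norm q ^ 5"
  have N: "N \<noteq> 0" using nz by (simp add: N_def)
  have d: "v / norm q ^ 3 = v * (q \<bullet> q) / N" for v
    unfolding N_def n[symmetric] using nz by (simp add: field_simps flip: power_add)
  show ?thesis
    unfolding gauss_form_deriv_def d N_def[symmetric] 1 
    using N cramer by (simp add: field_simps) algebra
qed

lemma continuous_on_gauss_form [continuous_intros]: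
  assumes "continuous_on S q" "continuous_on S x" "continuous_on S y" "\<And>p. p \<in> S \<Longrightarrow> q p \<noteq> 0"
  shows "continuous_on S (\<lambda>p. gauss_form (q p) (x p) (y p))"
  unfolding gauss_form_def using assms by (intro continuous_intros) auto

lemma continuous_on_gauss_form_deriv [continuous_intros]:
  assumes "continuous_on S q" "continuous_on S x" "continuous_on S y"
    "continuous_on S q'" "continuous_on S x'" "continuous_on S y'" "\<And>p. p \<in> S \<Longrightarrow> q p \<noteq> 0"
  shows "continuous_on S (\<lambda>p. gauss_form_deriv (q p) (x p) (y p) (q' p) (x' p) (y' p))"
  unfolding gauss_form_deriv_def using assms by (intro continuous_intros) auto

lemma gauss_form_neg: "gauss_form q (- x) y = - gauss_form q x y" "gauss_form q x (- y) = - gauss_form q x y"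
  by (simp_all add: gauss_form_def)

section \<open>Homotopies of closed chains of arcs\<close>

definition C1_arc :: "(real \<Rightarrow> real^3) \<Rightarrow> (real \<Rightarrow> real^3) \<Rightarrow> bool" where
  "C1_arc a a' \<longleftrightarrow> continuous_on {0..1} a' \<and>
     (\<forall>t\<in>{0..1}. (a has_vector_derivative a' t) (at t within {0..1}))"

lemma C1_arc_continuous: "C1_arc a a' \<Longrightarrow> continuous_on {0..1} a"
  unfolding C1_arc_def
  by (meson continuous_on_vector_derivative)

lemma C1_arc_diff: "C1_arc a a' \<Longrightarrow> C1_arc b b' \<Longrightarrow> C1_arc (\<lambda>t. a t - b t) (\<lambda>t. a' t - b' t)"
  unfolding C1_arc_def by (auto intro!: continuous_intros derivative_intros)

text \<open>\<open>a1\<close> and \<open>b1\<close> are the directions of an affine homotopy, not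
  its final curves. Differentiation under the integral and the divergence identity leave two total
  derivatives, one in each curve parameter, and the fundamental theorem reduces them to values at
  end points. \<open>P\<close> collects the ends of the first arc, \<open>R\<close> those of the
  second.\<close>

lemma gauss_integral_homotopy_derivative:
  fixes a0 a1 a0' a1' b0 b1 b0' b1' :: "real \<Rightarrow> real^3"
  defines "A \<equiv> \<lambda>s t. a0 t + s *\<^sub>R a1 t" and "A' \<equiv> \<lambda>s t. a0' t + s *\<^sub>R a1' t"
    and "B \<equiv> \<lambda>s t. b0 t + s *\<^sub>R b1 t" and "B' \<equiv> \<lambda>s t. b0' t + s *\<^sub>R b1' t"
  assumes arcs: "C1_arc a0 a0'" "C1_arc a1 a1'" "C1_arc b0 b0'" "C1_arc b1 b1'"
    and disj: "\<And>s t u. s \<in> {0..1} \<Longrightarrow> t \<in> {0..1} \<Longrightarrow> u \<in> {0..1} \<Longrightarrow> A s t \<noteq> B s u"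
    and s: "s \<in> {0..1}"
  defines "P \<equiv> \<lambda>t u. gauss_form (A s t - B s u) (a1 t - b1 u) (B' s u)"
    and "R \<equiv> \<lambda>t u. gauss_form (A s t - B s u) (a1 t - b1 u) (A' s t)"
  shows "((\<lambda>s. gauss_integral (A s) (A' s) (B s) (B' s)) has_real_derivative
     integral {0..1} (\<lambda>u. P 1 u - P 0 u) + integral {0..1} (\<lambda>t. R t 1 - R t 0))
     (at s within {0..1})"
proof -
  let ?I = "{0..1::real}"
  let ?Q = "cbox (0, 0) (1, 1) :: (real * real) set"
  note cont = arcs[THEN C1_arc_continuous]
  have cont': "continuous_on ?I a0'" "continuous_on ?I a1'" "continuous_on ?I b0'" "continuous_on ?I b1'"
    using arcs by (auto simp: C1_arc_def)
  note ci = cont[THEN continuous_on_compose2] cont'[THEN continuous_on_compose2]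
  have Q: "?Q = Sigma ?I (\<lambda>_. ?I)" by (auto simp: cbox_Pair_eq)
  define w where "w = (\<lambda>s (p::real*real). gauss_form (A s (fst p) - B s (snd p)) (A' s (fst p)) (B' s (snd p)))"
  define w' where "w' = (\<lambda>s (p::real*real). gauss_form_deriv (A s (fst p) - B s (snd p))
      (A' s (fst p)) (B' s (snd p)) (a1 (fst p) - b1 (snd p)) (a1' (fst p)) (b1' (snd p)))"
  \<comment> \<open>\<open>Pt\<close> is the derivative of \<open>P\<close> in its first argument
    and \<open>Ru\<close> that of \<open>R\<close> in its second; the signs in \<open>Ru\<close>
    arise because \<open>B\<close> and \<open>b1\<close> enter the differences negatively.\<close>
  define Pt where "Pt = (\<lambda>t u. gauss_form_deriv (A s t - B s u) (a1 t - b1 u) (B' s u) (A' s t) (a1' t) 0)"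
  define Ru where "Ru = (\<lambda>t u. gauss_form_deriv (A s t - B s u) (a1 t - b1 u) (A' s t) (- B' s u) (- b1' u) 0)"
  have cw: "continuous_on ?Q (w s)" if "s \<in> ?I" for s
    unfolding w_def A_def A'_def B_def B'_def using that disj
    by (intro continuous_intros ci) (auto simp: Q A_def B_def)
  have cw': "continuous_on (Sigma ?I (\<lambda>_. ?Q)) (\<lambda>(s, p). w' s p)"
    unfolding w'_def A_def A'_def B_def B'_def case_prod_unfold using disj
    by (intro continuous_intros ci) (auto simp: Q A_def B_def)
  have cPt: "continuous_on ?Q (\<lambda>(t, u). Pt t u)"
    unfolding Pt_def A_def A'_def B_def B'_def case_prod_unfold using s disj
    by (intro continuous_intros ci) (auto simp: Q A_def B_def)
  have cRu: "continuous_on ?Q (\<lambda>(t, u). Ru t u)"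
    unfolding Ru_def A_def A'_def B_def B'_def case_prod_unfold using s disj
    by (intro continuous_intros ci) (auto simp: Q A_def B_def)
  have gw: "gauss_integral (A s) (A' s) (B s) (B' s) = integral ?Q (w s)" if "s \<in> ?I" for s
    unfolding gauss_integral_def integral_prod_continuous[OF cw[OF that]]
    by (simp add: w_def)
  have "((\<lambda>s. integral ?Q (w s)) has_real_derivative integral ?Q (w' s)) (at s within ?I)"
  proof (rule leibniz_rule_field_derivative)
    fix s p assume sp: "s \<in> ?I" "p \<in> ?Q"
    show "((\<lambda>s. w s p) has_real_derivative w' s p) (at s within ?I)"
      unfolding w_def w'_def
      by (rule gauss_form_has_derivative)
        (use sp disj in \<open>auto simp: A_def A'_def B_def B'_def Q algebra_simps intro!: derivative_eq_intros\<close>)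
  next
    show "w s integrable_on ?Q" if "s \<in> ?I" for s
      using cw[OF that] by (rule integrable_continuous)
  qed (use cw' s in auto)
  moreover have "integral ?Q (w' s) = integral ?I (\<lambda>u. P 1 u - P 0 u) + integral ?I (\<lambda>t. R t 1 - R t 0)"
  proof -
    have "w' s p = Pt (fst p) (snd p) + Ru (fst p) (snd p)" if "p \<in> ?Q" for p
      unfolding w'_def Pt_def Ru_def
      by (rule gauss_form_deriv_closed) (use that s disj in \<open>auto simp: Q\<close>)
    hence "integral ?Q (w' s) = integral ?Q (\<lambda>p. (\<lambda>(t, u). Pt t u) p + (\<lambda>(t, u). Ru t u) p)"
      by (intro integral_cong) (auto simp: case_prod_unfold)
    also have "\<dots> = integral ?Q (\<lambda>(t, u). Pt t u) + integral ?Q (\<lambda>(t, u). Ru t u)"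
      by (intro integral_add integrable_continuous cPt cRu)
    also have "integral ?Q (\<lambda>(t, u). Pt t u) = integral ?I (\<lambda>u. integral ?I (\<lambda>t. Pt t u))"
      using integral_prod_continuous[OF cPt] integral_swap_continuous[OF cPt] by simp
    also have "integral ?I (\<lambda>u. integral ?I (\<lambda>t. Pt t u)) = integral ?I (\<lambda>u. P 1 u - P 0 u)"
    proof (rule integral_cong)
      fix u assume u: "u \<in> ?I"
      have "((\<lambda>t. Pt t u) has_integral (P 1 u - P 0 u)) ?I"
      proof (rule fundamental_theorem_of_calculus)
        fix t assume t: "t \<in> ?I"
        show "((\<lambda>t. P t u) has_vector_derivative Pt t u) (at t within ?I)"
          unfolding P_def Pt_def has_real_derivative_iff_has_vector_derivative[symmetric]
          by (rule gauss_form_has_derivative)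
           (use t s u disj arcs in \<open>auto simp: A_def A'_def B_def B'_def C1_arc_def intro!: derivative_eq_intros\<close>)
      qed simp
      thus "integral ?I (\<lambda>t. Pt t u) = P 1 u - P 0 u" by (rule integral_unique)
    qed
    also have "integral ?Q (\<lambda>(t, u). Ru t u) = integral ?I (\<lambda>t. integral ?I (Ru t))"
      using integral_prod_continuous[OF cRu] by simp
    also have "\<dots> = integral ?I (\<lambda>t. R t 1 - R t 0)"
    proof (rule integral_cong)
      fix t assume t: "t \<in> ?I"
      have "((\<lambda>u. Ru t u) has_integral (R t 1 - R t 0)) ?I"
      proof (rule fundamental_theorem_of_calculus)
        fix u assume u: "u \<in> ?I"
        show "((\<lambda>u. R t u) has_vector_derivative Ru t u) (at u within ?I)"
          unfolding R_def Ru_def has_real_derivative_iff_has_vector_derivative[symmetric]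
          by (rule gauss_form_has_derivative)
           (use t s u disj arcs in \<open>auto simp: A_def A'_def B_def B'_def C1_arc_def intro!: derivative_eq_intros\<close>)
      qed simp
      thus "integral ?I (Ru t) = R t 1 - R t 0" by (rule integral_unique)
    qed
    finally show ?thesis .
  qed
  ultimately have "((\<lambda>s. integral ?Q (w s)) has_real_derivative
     integral ?I (\<lambda>u. P 1 u - P 0 u) + integral ?I (\<lambda>t. R t 1 - R t 0)) (at s within ?I)" by simp
  thus ?thesis
    by (rule has_field_derivative_transform_within[where d = 1]) (use s gw in auto)
qed

lemma sum_cyclic_shift:
  fixes f :: "nat \<Rightarrow> 'a::ab_group_add"
  assumes "0 < k"
  shows "(\<Sum>i<k. f (Suc i mod k)) = (\<Sum>i<k. f i)"
proof -
  obtain m where m: "k = Suc m" using assms by (cases k) auto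
  have "(\<Sum>i<k. f (Suc i mod k)) = (\<Sum>i<m. f (Suc i)) + f 0"
    by (simp add: m)
  thus ?thesis by (simp add: m sum.lessThan_Suc_shift add.commute del: sum.lessThan_Suc)
qed

text \<open>The boundary terms of the homotopy derivative cancel cyclically.\<close>

theorem gauss_integral_homotopy:
  fixes a0 a1 a0' a1' b0 b1 b0' b1' :: "nat \<Rightarrow> real \<Rightarrow> real^3"
  assumes k: "0 < k"
    and arcs: "\<And>i. i < k \<Longrightarrow> C1_arc (a0 i) (a0' i)" "\<And>i. i < k \<Longrightarrow> C1_arc (a1 i) (a1' i)"
      "\<And>i. i < k \<Longrightarrow> C1_arc (b0 i) (b0' i)" "\<And>i. i < k \<Longrightarrow> C1_arc (b1 i) (b1' i)"
    and closed: "\<And>i. i < k \<Longrightarrow> a0 i 1 = a0 (Suc i mod k) 0" "\<And>i. i < k \<Longrightarrow> a1 i 1 = a1 (Suc i mod k) 0"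
      "\<And>i. i < k \<Longrightarrow> b0 i 1 = b0 (Suc i mod k) 0" "\<And>i. i < k \<Longrightarrow> b1 i 1 = b1 (Suc i mod k) 0"
    and disj: "\<And>i j s t u. i < k \<Longrightarrow> j < k \<Longrightarrow> s \<in> {0..1} \<Longrightarrow> t \<in> {0..1} \<Longrightarrow> u \<in> {0..1} \<Longrightarrow>
      (1 - s) *\<^sub>R a0 i t + s *\<^sub>R a1 i t \<noteq> (1 - s) *\<^sub>R b0 j u + s *\<^sub>R b1 j u"
  shows "(\<Sum>i<k. \<Sum>j<k. gauss_integral (a0 i) (a0' i) (b0 j) (b0' j)) =
    (\<Sum>i<k. \<Sum>j<k. gauss_integral (a1 i) (a1' i) (b1 j) (b1' j))"
proof -
  let ?I = "{0..1::real}"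
  define d where "d = (\<lambda>i t. a1 i t - a0 i t)"
  define d' where "d' = (\<lambda>i t. a1' i t - a0' i t)"
  define g where "g = (\<lambda>i t. b1 i t - b0 i t)"
  define g' where "g' = (\<lambda>i t. b1' i t - b0' i t)"
  define A where "A = (\<lambda>i s t. a0 i t + s *\<^sub>R d i t)"
  define A' where "A' = (\<lambda>i s t. a0' i t + s *\<^sub>R d' i t)"
  define B where "B = (\<lambda>i s t. b0 i t + s *\<^sub>R g i t)"
  define B' where "B' = (\<lambda>i s t. b0' i t + s *\<^sub>R g' i t)"
  have d: "C1_arc (d i) (d' i)" "C1_arc (g i) (g' i)" if "i < k" for i
    unfolding d_def d'_def g_def g'_def using that by (auto intro: C1_arc_diff arcs)
  have dis: "A i s t \<noteq> B j s u" if "i < k" "j < k" "s \<in> ?I" "t \<in> ?I" "u \<in> ?I" for i j s t u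
    using disj[OF that] by (simp add: A_def B_def d_def g_def algebra_simps)
  define F where "F = (\<lambda>s. \<Sum>i<k. \<Sum>j<k. gauss_integral (A i s) (A' i s) (B j s) (B' j s))"
  have "(F has_real_derivative 0) (at s within ?I)" if s: "s \<in> ?I" for s
  proof -
    define P where "P = (\<lambda>i j t u. gauss_form (A i s t - B j s u) (d i t - g j u) (B' j s u))"
    define R where "R = (\<lambda>i j t u. gauss_form (A i s t - B j s u) (d i t - g j u) (A' i s t))"
    have A_eq: "A i s 1 = A (Suc i mod k) s 0" "d i 1 = d (Suc i mod k) 0" if "i < k" for i
      using closed that by (auto simp: A_def d_def)
    have B_eq: "B i s 1 = B (Suc i mod k) s 0" "g i 1 = g (Suc i mod k) 0" if "i < k" for i
      using closed that by (auto simp: B_def g_def)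
    have cP: "continuous_on ?I (P i j t)" if "i < k" "j < k" "t \<in> ?I" for i j t
    proof -
      have "continuous_on ?I (\<lambda>u. gauss_form (A i s t - (b0 j u + s *\<^sub>R g j u)) (d i t - g j u) (b0' j u + s *\<^sub>R g' j u))"
        using arcs(3)[of j] d(2)[of j] dis[of i j s t] that s
        by (intro continuous_intros C1_arc_continuous[of "b0 j" "b0' j"] C1_arc_continuous[of "g j" "g' j"])
           (auto simp: C1_arc_def B_def)
      thus ?thesis by (simp add: P_def B_def B'_def)
    qed
    have cR: "continuous_on ?I (\<lambda>t. R i j t u)" if "i < k" "j < k" "u \<in> ?I" for i j u
    proof -
      have "continuous_on ?I (\<lambda>t. gauss_form ((a0 i t + s *\<^sub>R d i t) - B j s u) (d i t - g j u) (a0' i t + s *\<^sub>R d' i t))"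
        using arcs(1)[of i] d(1)[of i] dis[of i j s _ u] that s
        by (intro continuous_intros C1_arc_continuous[of "a0 i" "a0' i"] C1_arc_continuous[of "d i" "d' i"])
           (auto simp: C1_arc_def A_def)
      thus ?thesis by (simp add: R_def A_def A'_def)
    qed
    have "(F has_real_derivative (\<Sum>i<k. \<Sum>j<k. integral ?I (\<lambda>u. P i j 1 u - P i j 0 u)
        + integral ?I (\<lambda>t. R i j t 1 - R i j t 0))) (at s within ?I)"
      unfolding F_def P_def R_def A_def B_def A'_def B'_def
      by (intro DERIV_sum gauss_integral_homotopy_derivative)
         (use s d arcs dis in \<open>auto simp: A_def B_def\<close>)
    \<comment> \<open>The end points in \<open>P\<close> belong to the first curve and cancel in the
      sum over \<open>i\<close>, those in \<open>R\<close> belong to the second and cancel over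
      \<open>j\<close>; the sums in the first group are therefore exchanged.\<close>
    also have "(\<Sum>i<k. \<Sum>j<k. integral ?I (\<lambda>u. P i j 1 u - P i j 0 u) + integral ?I (\<lambda>t. R i j t 1 - R i j t 0))
       = (\<Sum>j<k. \<Sum>i<k. integral ?I (\<lambda>u. P i j 1 u - P i j 0 u))
         + (\<Sum>i<k. \<Sum>j<k. integral ?I (\<lambda>t. R i j t 1 - R i j t 0))"
      by (simp add: sum.distrib) (rule sum.swap)
    also have "(\<Sum>i<k. integral ?I (\<lambda>u. P i j 1 u - P i j 0 u)) = 0" if j: "j < k" for j
    proof -
      have "(\<Sum>i<k. integral ?I (\<lambda>u. P i j 1 u - P i j 0 u))
          = (\<Sum>i<k. integral ?I (P i j 1)) - (\<Sum>i<k. integral ?I (P i j 0))"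
        unfolding sum_subtractf[symmetric]
        by (intro sum.cong refl integral_diff integrable_continuous_real cP) (use j in auto)
      also have "(\<Sum>i<k. integral ?I (P i j 1)) = (\<Sum>i<k. integral ?I (P (Suc i mod k) j 0))"
        by (intro sum.cong refl) (simp add: P_def A_eq)
      also have "\<dots> = (\<Sum>i<k. integral ?I (P i j 0))" by (rule sum_cyclic_shift[OF k])
      finally show ?thesis by simp
    qed
    hence "(\<Sum>j<k. \<Sum>i<k. integral ?I (\<lambda>u. P i j 1 u - P i j 0 u)) = 0" by simp
    also have "(\<Sum>j<k. integral ?I (\<lambda>t. R i j t 1 - R i j t 0)) = 0" if i: "i < k" for i
    proof -
      have "(\<Sum>j<k. integral ?I (\<lambda>t. R i j t 1 - R i j t 0))
          = (\<Sum>j<k. integral ?I (\<lambda>t. R i j t 1)) - (\<Sum>j<k. integral ?I (\<lambda>t. R i j t 0))"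
        unfolding sum_subtractf[symmetric]
        by (intro sum.cong refl integral_diff integrable_continuous_real cR) (use i in auto)
      also have "(\<Sum>j<k. integral ?I (\<lambda>t. R i j t 1)) = (\<Sum>j<k. integral ?I (\<lambda>t. R i (Suc j mod k) t 0))"
        by (intro sum.cong refl) (simp add: R_def B_eq)
      also have "\<dots> = (\<Sum>j<k. integral ?I (\<lambda>t. R i j t 0))" by (rule sum_cyclic_shift[OF k])
      finally show ?thesis by simp
    qed
    hence "(\<Sum>i<k. \<Sum>j<k. integral ?I (\<lambda>t. R i j t 1 - R i j t 0)) = 0" by simp
    finally show ?thesis by simp
  qed
  hence "\<exists>c. \<forall>s\<in>?I. F s = c"
    by (intro has_field_derivative_zero_constant) auto
  hence "F 0 = F 1" by force
  thus ?thesis by (simp add: F_def A_def A'_def B_def B'_def d_def d'_def g_def g'_def)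
qed

section \<open>Vertical chords of a rounded curve\<close>

lemma vector_derivative_quotient_tendsto:
  assumes "(f has_vector_derivative f') (at t)"
  shows "((\<lambda>u. (f u - f t) /\<^sub>R (u - t)) \<longlongrightarrow> f') (at t)"
proof -
  have "((\<lambda>u. norm (f u - f t - (u - t) *\<^sub>R f') / norm (u - t)) \<longlongrightarrow> 0) (at t)"
    using assms by (simp add: has_vector_derivative_def has_derivative_iff_norm)
  hence "((\<lambda>u. norm ((f u - f t) /\<^sub>R (u - t) - f')) \<longlongrightarrow> 0) (at t)"
  proof (rule Lim_transform_eventually)
    show "eventually (\<lambda>u. norm (f u - f t - (u - t) *\<^sub>R f') / norm (u - t) =
        norm ((f u - f t) /\<^sub>R (u - t) - f')) (at t)"
    proof (rule eventually_mono[OF eventually_neq_at_within[of t]])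
      fix u assume "u \<noteq> t"
      hence "(f u - f t) /\<^sub>R (u - t) - f' = (f u - f t - (u - t) *\<^sub>R f') /\<^sub>R (u - t)"
        by (simp add: scaleR_diff_right)
      thus "norm (f u - f t - (u - t) *\<^sub>R f') / norm (u - t) = norm ((f u - f t) /\<^sub>R (u - t) - f')"
        by (simp add: divide_inverse mult.commute)
    qed
  qed
  thus ?thesis by (rule Lim_null[THEN iffD2, OF tendsto_norm_zero_cancel])
qed

text \<open>To first order alone the curve could be tangent to both spheres; the second derivative rules
  this out, because it would have to bend into both balls at once.\<close>

lemma crosses_touching_balls:
  fixes g g' :: "real \<Rightarrow> 'a::real_inner"
  assumes g: "\<And>u. u \<in> {t - e<..<t + e} \<Longrightarrow> (g has_vector_derivative g' u) (at u)"
    and g': "(g' has_vector_derivative g'') (at t)" and nz: "g' t \<noteq> 0" and e: "0 < e"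
    and before: "\<And>u. t - e < u \<Longrightarrow> u < t \<Longrightarrow> g u \<in> ball (g t - n) (norm n)"
    and after: "\<And>u. t < u \<Longrightarrow> u < t + e \<Longrightarrow> g u \<in> ball (g t + n) (norm n)"
  shows "0 < n \<bullet> g' t"
proof -
  \<comment> \<open>Membership in the balls reads \<open>2 * \<phi> u < - |g u - g t|^2\<close>
    before \<open>t\<close> and \<open>2 * \<phi> u > |g u - g t|^2\<close> after it. Division by
    \<open>(u - t)^2\<close> turns this into bounds of the second-order quotient of
    \<open>\<phi>\<close> by \<open>- G / 2\<close> and \<open>G / 2\<close>, where \<open>G\<close>
    tends to the squared speed.\<close>
  define \<phi> where "\<phi> = (\<lambda>u. n \<bullet> (g u - g t))"
  define G where "G = (\<lambda>u. norm ((g u - g t) /\<^sub>R (u - t)) ^ 2)"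
  have nball: "norm (x + n) < norm n \<longleftrightarrow> x \<bullet> x + 2 * (n \<bullet> x) < 0" for x
  proof -
    have "norm (x + n) < norm n \<longleftrightarrow> (norm (x + n))\<^sup>2 < (norm n)\<^sup>2"
      by (metis norm_ge_zero power_mono_iff not_le zero_less_numeral)
    thus ?thesis by (simp add: power2_norm_eq_inner algebra_simps inner_commute)
  qed
  have left: "\<phi> u / (u - t)^2 \<le> - (G u / 2)" if "t - e < u" "u < t" for u
  proof -
    have "norm ((g u - g t) + n) < norm n"
      using before[OF that] by (simp add: dist_norm norm_minus_commute algebra_simps)
    hence "2 * \<phi> u \<le> - (norm (g u - g t))\<^sup>2"
      unfolding nball by (simp add: \<phi>_def power2_norm_eq_inner)
    thus ?thesis using that by (simp add: G_def power_mult_distrib divide_simps mult_ac)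
  qed
  have right: "G u / 2 \<le> \<phi> u / (u - t)^2" if "t < u" "u < t + e" for u
  proof -
    have "norm ((g t - g u) + n) < norm n"
      using after[OF that] by (simp add: dist_norm norm_minus_commute algebra_simps)
    hence "(norm (g u - g t))\<^sup>2 \<le> 2 * \<phi> u"
      unfolding nball by (simp add: \<phi>_def power2_norm_eq_inner inner_diff_right norm_minus_commute algebra_simps inner_commute)
    thus ?thesis using that by (simp add: G_def power_mult_distrib divide_simps mult_ac)
  qed
  have \<phi>: "(\<phi> has_real_derivative n \<bullet> g' u) (at u)" if "u \<in> {t - e<..<t + e}" for u
    unfolding \<phi>_def has_real_derivative_iff_has_vector_derivative
    using g[OF that] by (auto intro!: derivative_eq_intros bounded_linear.has_vector_derivative[OF bounded_linear_inner_right])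
  have G: "(G \<longlongrightarrow> (norm (g' t))\<^sup>2) (at t)"
    unfolding G_def using g[of t] e
    by (intro tendsto_intros vector_derivative_quotient_tendsto) auto
  have ev: "eventually (\<lambda>u. u \<in> {t - e<..<t + e}) (at t)"
    using e by (intro eventually_at_in_open') auto
  have quot: "((\<lambda>u. (n \<bullet> h u - n \<bullet> h t) / (u - t)) \<longlongrightarrow> n \<bullet> h') (at t)"
    if "(h has_vector_derivative h') (at t)" for h :: "real \<Rightarrow> 'a" and h'
    using tendsto_inner[OF tendsto_const vector_derivative_quotient_tendsto[OF that], of n]
    by (simp add: inner_diff_right divide_inverse mult.commute)
  have "0 \<le> n \<bullet> g' t"
  proof (rule tendsto_lowerbound)
    show "((\<lambda>u. (n \<bullet> g u - n \<bullet> g t) / (u - t)) \<longlongrightarrow> n \<bullet> g' t) (at_right t)"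
      by (rule tendsto_mono[OF at_le quot[OF g]]) (use e in auto)
    have "0 \<le> (n \<bullet> g u - n \<bullet> g t) / (u - t)" if "t < u" "u < t + e" for u
    proof -
      have "0 \<le> \<phi> u / (u - t)\<^sup>2" using right[OF that] by (rule order_trans[rotated]) (simp add: G_def)
      hence "0 \<le> \<phi> u" using that by (simp add: zero_le_divide_iff)
      thus ?thesis using that by (simp add: \<phi>_def inner_diff_right)
    qed
    thus "eventually (\<lambda>u. 0 \<le> (n \<bullet> g u - n \<bullet> g t) / (u - t)) (at_right t)"
      using eventually_at_right_real[of t "t + e"] e by (auto elim!: eventually_mono)
  qed simp
  moreover have "n \<bullet> g' t \<noteq> 0"
  proof
    assume z: "n \<bullet> g' t = 0"
    have "((\<lambda>u. (n \<bullet> g' u) / (2 * (u - t))) \<longlongrightarrow> (n \<bullet> g'') / 2) (at t)"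
      using tendsto_divide[OF quot[OF g'] tendsto_const[of 2]] z by (simp add: field_simps)
    have lim: "((\<lambda>u. \<phi> u / (u - t)^2) \<longlongrightarrow> (n \<bullet> g'') / 2) (at t)"
    proof (rule lhopital)
      show "(\<phi> \<longlongrightarrow> 0) (at t)"
        using DERIV_isCont[OF \<phi>[of t]] e by (simp add: isCont_def) (simp add: \<phi>_def)
      show "((\<lambda>u. (u - t)\<^sup>2) \<longlongrightarrow> 0) (at t)" by (auto intro!: tendsto_eq_intros)
      show "eventually (\<lambda>u. (u - t)\<^sup>2 \<noteq> 0) (at t)" "eventually (\<lambda>u. 2 * (u - t) \<noteq> 0) (at t)"
        by (auto simp: eventually_at_filter)
      show "eventually (\<lambda>u. DERIV \<phi> u :> n \<bullet> g' u) (at t)"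
        using ev by (rule eventually_mono) (rule \<phi>)
      show "eventually (\<lambda>u. DERIV (\<lambda>u. (u - t)\<^sup>2) u :> 2 * (u - t)) (at t)"
        by (intro always_eventually allI) (auto intro!: derivative_eq_intros)
    qed fact
    have "n \<bullet> g'' / 2 \<le> - ((norm (g' t))\<^sup>2 / 2)"
    proof (rule tendsto_le)
      show "((\<lambda>u. \<phi> u / (u - t)^2) \<longlongrightarrow> (n \<bullet> g'') / 2) (at_left t)"
        using lim by (rule tendsto_mono[rotated]) (simp add: at_le)
      show "((\<lambda>u. - (G u / 2)) \<longlongrightarrow> - ((norm (g' t))\<^sup>2 / 2)) (at_left t)"
        by (intro tendsto_intros tendsto_mono[OF _ G]) (simp_all add: at_le)
      show "eventually (\<lambda>u. \<phi> u / (u - t)^2 \<le> - (G u / 2)) (at_left t)"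
        using eventually_at_left_real[of "t - e" t] e by (auto elim!: eventually_mono intro: left)
    qed simp
    moreover have "(norm (g' t))\<^sup>2 / 2 \<le> n \<bullet> g'' / 2"
    proof (rule tendsto_le)
      show "((\<lambda>u. \<phi> u / (u - t)^2) \<longlongrightarrow> (n \<bullet> g'') / 2) (at_right t)"
        using lim by (rule tendsto_mono[rotated]) (simp add: at_le)
      show "((\<lambda>u. (G u / 2)) \<longlongrightarrow> ((norm (g' t))\<^sup>2 / 2)) (at_right t)"
        by (intro tendsto_intros tendsto_mono[OF _ G]) (simp_all add: at_le)
      show "eventually (\<lambda>u. G u / 2 \<le> \<phi> u / (u - t)^2) (at_right t)"
        by (rule eventually_mono[OF eventually_at_right_real[of t "t + e"]]) (use e right in auto)
    qed simp
    ultimately have "(norm (g' t))\<^sup>2 \<le> 0" by linarith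
    thus False using nz by simp
  qed
  ultimately show ?thesis by simp
qed

section \<open>The straight-line homotopy from a cornered curve to its rounding\<close>

lemma periodic_int_shift:
  fixes f :: "real \<Rightarrow> 'a" and m :: int
  assumes "\<And>t. f (t + c) = f t"
  shows "f (t + of_int m * c) = f t"
proof -
  have n: "f (t + real n * c) = f t" for n t
  proof (induction n)
    case (Suc n)
    have "t + real (Suc n) * c = (t + real n * c) + c" by (simp add: algebra_simps)
    thus ?case using assms Suc by metis
  qed simp
  show ?thesis
  proof (cases "0 \<le> m")
    case True thus ?thesis using n[of t "nat m"] by simp
  next
    case False thus ?thesis using n[of "t + of_int m * c" "nat (- m)"] by simp
  qed
qed

text \<open>A cornered curve and its rounding with the corner data indexed by all integers, so that
  arguments near a corner need no case distinction at the ends of a period. \<open>K'\<close> and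
  \<open>K''\<close> describe \<open>K\<close> only between corners. Second derivatives enter
  because of points where two balls touch; \<open>2 \<le> k\<close> keeps consecutive corners
  distinct and makes the window in \<open>ball_iff\<close> reach the neighbouring corners.\<close>

locale rounded_curve =
  fixes k :: nat and K K' K'' L L' L'' :: "real \<Rightarrow> real^3" and r :: real
    and a b :: "int \<Rightarrow> real" and w :: "int \<Rightarrow> real^3"
  assumes k: "2 \<le> k"
    and K_period: "\<And>t. K (t + real k) = K t"
    and K_inj: "inj_on K {0..<real k}"
    and K_cont: "continuous_on UNIV K"
    and K': "\<And>t. t \<notin> \<int> \<Longrightarrow> (K has_vector_derivative K' t) (at t)"
    and K'': "\<And>t. t \<notin> \<int> \<Longrightarrow> (K' has_vector_derivative K'' t) (at t)"
    and K_leg: "\<And>t. t \<notin> \<int> \<Longrightarrow> K' t \<noteq> 0 \<and> K' t \<in> xi_std (K t)"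
    and L_period: "\<And>t. L (t + real k) = L t"
    and L': "\<And>t. (L has_vector_derivative L' t) (at t)"
    and L'': "\<And>t. (L' has_vector_derivative L'' t) (at t)"
    and L_leg: "\<And>t. L' t \<noteq> 0 \<and> L' t \<in> xi_std (L t)"
    and r: "0 < r"
    and balls_disjoint: "\<And>i j. i mod int k \<noteq> j mod int k \<Longrightarrow>
      ball (K (of_int i)) r \<inter> ball (K (of_int j)) r = {}"
    and L_eq_K: "\<And>t. (\<And>i::int. K t \<notin> ball (K (of_int i)) r) \<Longrightarrow> L t = K t"
    and arc: "\<And>i. of_int i - 1 < a i \<and> a i < of_int i \<and> of_int i < b i \<and> b i < of_int i + 1"
    and w_horizontal: "\<And>i. w i $ 3 = 0"
    and ball_iff: "\<And>i t. t \<in> {of_int i - real k / 2..of_int i + real k / 2} \<Longrightarrow>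
      K t \<in> ball (K (of_int i)) r \<longleftrightarrow> t \<in> {a i<..<b i}"
    and L_ball: "\<And>i t. t \<in> {a i<..<b i} \<Longrightarrow> L t \<in> ball (K (of_int i)) r"
    and L_forward: "\<And>i t. t \<in> {a i<..<b i} \<Longrightarrow> 0 < w i \<bullet> L' t"
    and K_forward: "\<And>i t. t \<in> {a i<..<b i} \<Longrightarrow> t \<noteq> of_int i \<Longrightarrow> 0 < w i \<bullet> K' t"
begin

lemmas K_shift = periodic_int_shift[of K "real k", OF K_period] and L_shift = periodic_int_shift[of L "real k", OF L_period]

lemma K_mod_cong:
  assumes "i mod int k = j mod int k"
  shows "K (of_int i) = K (of_int j)"
proof -
  obtain m where "i - j = m * int k" using assms by (metis mod_eq_dvd_iff dvdE mult.commute)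
  hence "real_of_int i = of_int j + of_int m * real k"
    by (metis add_diff_cancel_left' add_diff_eq diff_add_cancel of_int_add of_int_mult of_int_of_nat_eq add.commute)
  thus ?thesis using K_shift by metis
qed

definition C :: "real \<Rightarrow> real \<Rightarrow> real^3" where "C s t = (1 - s) *\<^sub>R K t + s *\<^sub>R L t"

lemma C_shift: "C s (t + of_int m * real k) = C s t"
  by (simp add: C_def K_shift L_shift)

lemma ex_shift: "\<exists>m::int. t + of_int m * real k \<in> {c..<c + real k}"
proof
  define x where "x = (t - c) / real k"
  have k0: "0 < real k" using k by simp
  have t: "t = c + x * real k" using k0 by (simp add: x_def)
  have e: "t + of_int (- \<lfloor>x\<rfloor>) * real k = c + frac x * real k"
    unfolding t frac_def by (simp add: algebra_simps)
  have "0 \<le> frac x * real k" "frac x * real k < 1 * real k"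
    using k0 frac_lt_1[of x] by (auto intro!: mult_strict_right_mono)
  thus "t + of_int (- \<lfloor>x\<rfloor>) * real k \<in> {c..<c + real k}" unfolding e by auto
qed

lemma near_corner_shift:
  assumes "K t \<in> ball (K (of_int i)) r"
  obtains m :: int where "t + of_int m * real k \<in> {a i<..<b i}"
proof -
  obtain m :: int where m: "t + of_int m * real k \<in> {of_int i - real k / 2..<of_int i - real k / 2 + real k}"
    using ex_shift by blast
  have "K (t + of_int m * real k) \<in> ball (K (of_int i)) r"
    using assms by (simp only: K_shift)
  hence "t + of_int m * real k \<in> {a i<..<b i}"
    using ball_iff[of "t + of_int m * real k" i] m by auto
  thus ?thesis by (rule that)
qed

text \<open>Balls are convex and contain \<open>L t\<close> along with \<open>K t\<close>, so the
  homotopy cannot carry a point out of the ball of its corner.\<close>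

lemma C_near_corner:
  assumes "K t \<in> ball (K (of_int i)) r" "s \<in> {0..1}"
  shows "C s t \<in> ball (K (of_int i)) r"
proof -
  obtain m :: int where "t + of_int m * real k \<in> {a i<..<b i}"
    using near_corner_shift[OF assms(1)] .
  hence "L t \<in> ball (K (of_int i)) r" using L_ball L_shift by metis
  thus ?thesis
    unfolding C_def using assms by (intro convexD convex_ball) auto
qed

lemma L_increasing:
  assumes "x \<in> {a i<..<b i}" "y \<in> {a i<..<b i}" "x < y"
  shows "w i \<bullet> L x < w i \<bullet> L y"
proof (rule DERIV_pos_imp_increasing[OF \<open>x < y\<close>])
  fix z assume "x \<le> z" "z \<le> y"
  have "((\<lambda>t. w i \<bullet> L t) has_real_derivative w i \<bullet> L' z) (at z)"
    unfolding has_real_derivative_iff_has_vector_derivative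
    by (rule bounded_linear.has_vector_derivative[OF bounded_linear_inner_right L'])
  thus "\<exists>y. ((\<lambda>t. w i \<bullet> L t) has_real_derivative y) (at z) \<and> 0 < y"
    using L_forward[of z i] assms \<open>x \<le> z\<close> \<open>z \<le> y\<close> by auto
qed

text \<open>\<open>K\<close> need not have a derivative at the corner itself. Monotonicity holds on
  either side of \<open>of_int i\<close>, and continuity joins the two sides.\<close>

lemma K_increasing:
  assumes "x \<in> {a i<..<b i}" "y \<in> {a i<..<b i}" "x < y"
  shows "w i \<bullet> K x < w i \<bullet> K y"
proof -
  have *: "w i \<bullet> K x < w i \<bullet> K y"
    if "x \<in> {a i<..<b i}" "y \<in> {a i<..<b i}" "x < y" "of_int i \<notin> {x<..<y}" for x y
  proof (rule DERIV_pos_imp_increasing_open[OF \<open>x < y\<close>])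
    fix z assume z: "x < z" "z < y"
    have zi: "z \<noteq> of_int i" "of_int i - 1 < z" "z < of_int i + 1" using that z arc[of i] by auto
    have "z \<notin> \<int>"
    proof
      assume "z \<in> \<int>"
      then obtain n :: int where n: "z = of_int n" by (auto elim: Ints_cases)
      have "i - 1 < n" "n < i + 1" using zi(2,3) unfolding n by linarith+
      hence "n = i" by simp
      thus False using zi(1) n by simp
    qed
    hence "((\<lambda>t. w i \<bullet> K t) has_real_derivative w i \<bullet> K' z) (at z)"
      unfolding has_real_derivative_iff_has_vector_derivative
      by (intro bounded_linear.has_vector_derivative[OF bounded_linear_inner_right K'])
    thus "\<exists>y. ((\<lambda>t. w i \<bullet> K t) has_real_derivative y) (at z) \<and> 0 < y"
      using K_forward[of z i] that z zi by auto
  next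
    show "continuous_on {x..y} (\<lambda>t. w i \<bullet> K t)"
      by (intro continuous_intros continuous_on_subset[OF K_cont]) auto
  qed
  show ?thesis
  proof (cases "of_int i \<in> {x<..<y}")
    case True
    thus ?thesis using *[of x "of_int i"] *[of "of_int i" y] assms by auto
  qed (use * assms in auto)
qed

lemma C_increasing:
  assumes "v \<bullet> K x < v \<bullet> K y" "v \<bullet> L x < v \<bullet> L y" "s \<in> {0..1}"
  shows "v \<bullet> C s x < v \<bullet> C s y"
proof (cases "s = 1")
  case False
  have "(1 - s) * (v \<bullet> K x) < (1 - s) * (v \<bullet> K y)" using assms False by simp
  moreover have "s * (v \<bullet> L x) \<le> s * (v \<bullet> L y)" using assms by (intro mult_left_mono) auto
  ultimately show ?thesis by (simp add: C_def inner_add_right)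
qed (use assms in \<open>simp add: C_def\<close>)

text \<open>All stages of the homotopy are embedded closed curves. A point from the ball of a corner
  can only coincide with another one from the same ball, because the balls are disjoint and outside
  them \<open>C s\<close> equals \<open>K\<close>; within one ball \<open>C s\<close> strictly
  increases in the direction \<open>w i\<close>. Away from the balls \<open>K_inj\<close>
  applies.\<close>

lemma C_injective:
  assumes eq: "C s t = C s u" and s: "s \<in> {0..1}"
  shows "\<exists>m::int. t = u + of_int m * real k"
proof -
  have *: "\<exists>m::int. t = u + of_int m * real k"
    if t: "K t \<in> ball (K (of_int i)) r" and eq: "C s t = C s u" for t u i
  proof -
    have Ct: "C s t \<in> ball (K (of_int i)) r" using C_near_corner[OF t s] .
    have "K u \<in> ball (K (of_int i)) r"
    proof (cases "\<exists>j. K u \<in> ball (K (of_int j)) r")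
      case True
      then obtain j where j: "K u \<in> ball (K (of_int j)) r" by blast
      hence "C s u \<in> ball (K (of_int j)) r" using C_near_corner s by blast
      hence "i mod int k = j mod int k" using balls_disjoint[of i j] Ct eq by (metis IntI empty_iff)
      thus ?thesis using j K_mod_cong by metis
    next
      case False
      hence "L u = K u" using L_eq_K by blast
      hence "C s u = K u" by (simp add: C_def flip: scaleR_left_distrib)
      thus ?thesis using Ct eq by simp
    qed
    then obtain n :: int where n: "u + of_int n * real k \<in> {a i<..<b i}" by (rule near_corner_shift)
    obtain m :: int where m: "t + of_int m * real k \<in> {a i<..<b i}" using t by (rule near_corner_shift)
    have "\<not> t + of_int m * real k < u + of_int n * real k"
      using C_increasing[OF K_increasing[OF m n] L_increasing[OF m n] s] eq by (auto simp: C_shift)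
    moreover have "\<not> u + of_int n * real k < t + of_int m * real k"
      using C_increasing[OF K_increasing[OF n m] L_increasing[OF n m] s] eq by (auto simp: C_shift)
    ultimately have "t = u + of_int (n - m) * real k" by (simp add: algebra_simps)
    thus ?thesis by blast
  qed
  show ?thesis
  proof (cases "(\<exists>i. K t \<in> ball (K (of_int i)) r) \<or> (\<exists>i. K u \<in> ball (K (of_int i)) r)")
    case True
    thus ?thesis
    proof
      assume "\<exists>i. K u \<in> ball (K (of_int i)) r"
      then obtain m :: int where "u = t + of_int m * real k" using *[of u] eq by metis
      hence "t = u + of_int (- m) * real k" by simp
      thus ?thesis by blast
    qed (use * eq in blast)
  next
    case False
    hence "L t = K t" "L u = K u" using L_eq_K by blast+
    hence "K t = K u" using eq by (simp add: C_def flip: scaleR_left_distrib)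
    moreover obtain m n :: int where mn: "t + of_int m * real k \<in> {0..<0 + real k}"
      "u + of_int n * real k \<in> {0..<0 + real k}" using ex_shift by metis
    ultimately have "t + of_int m * real k = u + of_int n * real k"
      using K_inj by (auto simp: inj_on_def K_shift)
    hence "t = u + of_int (n - m) * real k" by (simp add: algebra_simps)
    thus ?thesis by blast
  qed
qed

text \<open>\<open>n\<close> is replaced by the horizontal vector that induces the same functional on the contact
  plane at \<open>K t\<close>, which contains both derivatives.\<close>

lemma horizontal_direction:
  assumes L: "L t = K t" and t: "t \<notin> \<int>" and n: "0 < n \<bullet> K' t" "0 < n \<bullet> L' t"
  shows "\<exists>v. v $ 3 = 0 \<and> 0 < v \<bullet> K' t \<and> 0 < v \<bullet> L' t"
proof -
  \<comment> \<open>On the contact plane at \<open>K t\<close> the third coordinate of a vector is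
    \<open>K t $ 2\<close> times its first, so the component \<open>n $ 3\<close> can be moved into
    the first coefficient.\<close>
  define v :: "real^3" where "v = vector [n $ 1 + K t $ 2 * n $ 3, n $ 2, 0]"
  have "v \<bullet> x = n \<bullet> x" if "x \<in> xi_std (K t)" for x
    using that by (simp add: v_def xi_std_def inner_vec_def sum_3 algebra_simps)
  moreover have "K' t \<in> xi_std (K t)" "L' t \<in> xi_std (K t)" using K_leg[OF t] L_leg[of t] L by auto
  moreover have "v $ 3 = 0" by (simp add: v_def)
  ultimately show ?thesis using n by metis
qed

lemma Ints_near_corner: "t \<in> \<int> \<Longrightarrow> \<exists>i. K t \<in> ball (K (of_int i)) r"
  using r by (metis Ints_cases centre_in_ball)

text \<open>The arc in a ball stays within distance 1 of its corner parameter, so on the open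
  interval between two consecutive corners only their own balls can be met: one before
  \<open>b m\<close>, the other after \<open>a (m + 1)\<close>.\<close>

lemma ball_iff_between:
  assumes u: "of_int m < u" "u < of_int m + 1"
  shows "K u \<in> ball (K (of_int m)) r \<longleftrightarrow> u < b m"
    "K u \<in> ball (K (of_int (m + 1))) r \<longleftrightarrow> a (m + 1) < u"
    "(\<exists>i. K u \<in> ball (K (of_int i)) r) \<longleftrightarrow> u < b m \<or> a (m + 1) < u"
proof -
  show 1: "K u \<in> ball (K (of_int m)) r \<longleftrightarrow> u < b m"
    using ball_iff[of u m] u k arc[of m] by auto
  show 2: "K u \<in> ball (K (of_int (m + 1))) r \<longleftrightarrow> a (m + 1) < u"
    using ball_iff[of u "m + 1"] u k arc[of "m + 1"] by auto
  have "i mod int k = m mod int k \<or> i mod int k = (m + 1) mod int k"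
    if near: "K u \<in> ball (K (of_int i)) r" for i
  proof -
    obtain q :: int where "u + of_int q * real k \<in> {a i<..<b i}"
      using near_corner_shift[OF near] .
    hence "of_int i - 1 < u + of_int (q * int k)" "u + of_int (q * int k) < of_int i + 1"
      using arc[of i] by auto
    hence "real_of_int (m + q * int k) < of_int (i + 1)" "real_of_int (i - 1) < of_int (m + 1 + q * int k)"
      using u by simp_all
    hence "m + q * int k < i + 1" "i - 1 < m + 1 + q * int k" by (simp_all only: of_int_less_iff)
    hence "i = m + q * int k \<or> i = m + 1 + q * int k" by auto
    thus ?thesis by auto
  qed
  thus "(\<exists>i. K u \<in> ball (K (of_int i)) r) \<longleftrightarrow> u < b m \<or> a (m + 1) < u"
    using 1 2 K_mod_cong by metis
qed

text \<open>Outside the balls the curves agree as points, and if they do so on a whole interval,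
  their derivatives agree too. In the remaining case \<open>t\<close> is an isolated point at which
  the balls of two consecutive corners touch; both curves pass there from one ball into the other,
  which gives a common direction along the line of centres.\<close>

lemma common_direction:
  assumes away: "\<And>i. K t \<notin> ball (K (of_int i)) r"
  shows "\<exists>v. v $ 3 = 0 \<and> 0 < v \<bullet> K' t \<and> 0 < v \<bullet> L' t"
proof -
  have tZ: "t \<notin> \<int>" using away Ints_near_corner by blast
  have Lt: "L t = K t" using away by (rule L_eq_K)
  define m where "m = \<lfloor>t\<rfloor>"
  have m: "of_int m < t" "t < of_int m + 1"
    using tZ unfolding m_def by (metis Ints_of_int floor_correct le_less, simp)
  have bt: "b m \<le> t" "t \<le> a (m + 1)" using ball_iff_between(3)[OF m] away by force+
  let ?J = "{b m..a (m + 1)}"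
  have L_eq: "L u = K u" if "u \<in> ?J" for u
  proof (rule L_eq_K)
    have "of_int m < u" "u < of_int m + 1" using that arc[of m] arc[of "m + 1"] by auto
    thus "K u \<notin> ball (K (of_int i)) r" for i using ball_iff_between(3)[of m u] that by force
  qed
  show ?thesis
  proof (cases "b m < a (m + 1)")
    case True
    have "K' t = L' t"
    proof (rule vector_derivative_unique_within)
      have "t islimpt ?J" using True bt by (simp add: islimpt_Icc)
      thus "at t within ?J \<noteq> bot" by (simp add: trivial_limit_within)
      show "(K has_vector_derivative K' t) (at t within ?J)"
        using K'[OF tZ] by (rule has_vector_derivative_at_within)
      show "(K has_vector_derivative L' t) (at t within ?J)"
        by (rule has_vector_derivative_transform_within[OF has_vector_derivative_at_within[OF L'], of 1])
           (use bt L_eq in auto)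
    qed
    moreover have "0 < K' t \<bullet> K' t" using K_leg[OF tZ] by simp
    ultimately show ?thesis using horizontal_direction[OF Lt tZ, of "K' t"] by simp
  next
    case False
    hence bm: "b m = t" and am: "a (m + 1) = t" using bt by auto
    let ?c = "K (of_int m)" and ?d = "K (of_int (m + 1))"
    have Kt: "isCont K t" using K_cont by (simp add: continuous_on_eq_continuous_at)
    have in_m: "K u \<in> ball ?c r" if "of_int m < u" "u < t" for u
      using ball_iff_between(1)[of m u] that m bm by auto
    have in_m1: "K u \<in> ball ?d r" if "t < u" "u < of_int m + 1" for u
      using ball_iff_between(2)[of m u] that m am by auto
    \<comment> \<open>\<open>K t\<close> is approached from inside the first ball on the left and
      from inside the second on the right without lying in either, so its distance from both centres
      is exactly \<open>r\<close>.\<close>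
    have "dist ?c (K t) \<le> r"
    proof (rule tendsto_upperbound)
      show "((\<lambda>u. dist ?c (K u)) \<longlongrightarrow> dist ?c (K t)) (at_left t)"
        by (intro tendsto_intros tendsto_mono[OF at_le Kt[unfolded isCont_def]]) auto
      show "eventually (\<lambda>u. dist ?c (K u) \<le> r) (at_left t)"
        by (rule eventually_mono[OF eventually_at_left_real[OF m(1)]]) (use in_m in force)
    qed simp
    moreover have "dist ?d (K t) \<le> r"
    proof (rule tendsto_upperbound)
      show "((\<lambda>u. dist ?d (K u)) \<longlongrightarrow> dist ?d (K t)) (at_right t)"
        by (intro tendsto_intros tendsto_mono[OF at_le Kt[unfolded isCont_def]]) auto
      show "eventually (\<lambda>u. dist ?d (K u) \<le> r) (at_right t)"
        by (rule eventually_mono[OF eventually_at_right_real[OF m(2)]]) (use in_m1 in force)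
    qed simp
    ultimately have dist: "dist ?c (K t) = r" "dist ?d (K t) = r"
      using away[of m] away[of "m + 1"] by (auto simp: not_less)
    have ne: "m mod int k \<noteq> (m + 1) mod int k"
    proof
      assume "m mod int k = (m + 1) mod int k"
      hence "int k dvd 1" by (simp add: mod_eq_dvd_iff)
      thus False using k by simp
    qed
    define n where "n = K t - ?c"
    have n: "norm n = r" using dist by (simp add: n_def dist_norm norm_minus_commute)
    \<comment> \<open>Two disjoint balls of equal radius with a common boundary point lie opposite
      each other. Otherwise, by the parallelogram law, the centres would be closer than
      \<open>2 * r\<close> and their midpoint would belong to both balls.\<close>
    have d: "?d = K t + n"
    proof (rule ccontr)
      assume *: "?d \<noteq> K t + n"
      define x where "x = ?d - K t"
      define p where "p = midpoint ?c ?d"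
      have nx: "norm x = r" using dist by (simp add: x_def dist_norm)
      have "x - n \<noteq> 0" using * by (simp add: x_def algebra_simps)
      hence "0 < (norm (x - n))\<^sup>2" by simp
      moreover have "(norm (x + n))\<^sup>2 + (norm (x - n))\<^sup>2 = 4 * r\<^sup>2"
      proof -
        have "n \<bullet> n = r\<^sup>2" "x \<bullet> x = r\<^sup>2" using nx n by (simp_all add: dot_square_norm)
        thus ?thesis by (simp add: power2_norm_eq_inner algebra_simps inner_commute)
      qed
      moreover have "(2 * r)\<^sup>2 = 4 * r\<^sup>2" by (simp add: power_mult_distrib)
      ultimately have "(norm (x + n))\<^sup>2 < (2 * r)\<^sup>2" by linarith
      hence "norm (x + n) < 2 * r" using r by (intro power2_less_imp_less[of _ "2 * r"]) auto
      moreover have "dist ?c ?d = norm (x + n)"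
        by (simp add: x_def n_def dist_norm norm_minus_commute)
      ultimately have "dist ?c p < r" "dist ?d p < r" by (simp_all add: p_def dist_midpoint)
      hence "p \<in> ball ?c r \<inter> ball ?d r" by simp
      thus False using balls_disjoint[OF ne] by blast
    qed
    have c: "?c = K t - n" by (simp add: n_def)
    define e where "e = min (t - of_int m) (of_int m + 1 - t)"
    have e: "0 < e" using m by (simp add: e_def)
    have notZ: "u \<notin> \<int>" if "of_int m < u" "u < of_int m + 1" for u :: real
    proof
      assume "u \<in> \<int>"
      then obtain q :: int where "u = of_int q" by (auto elim: Ints_cases)
      thus False using that by simp
    qed
    have "0 < n \<bullet> K' t"
    proof (rule crosses_touching_balls[of t e K K', OF _ K''[OF tZ] _ e])
      show "K u \<in> ball (K t - n) (norm n)" if "t - e < u" "u < t" for u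
        using in_m[of u] that unfolding c n e_def by auto
      show "K u \<in> ball (K t + n) (norm n)" if "t < u" "u < t + e" for u
        using in_m1[of u] that unfolding d n e_def by auto
    qed (use K' notZ K_leg[OF tZ] in \<open>auto simp: e_def\<close>)
    moreover have "0 < n \<bullet> L' t"
    proof (rule crosses_touching_balls[of t e L L', OF L' L'' _ e])
      show "L u \<in> ball (L t - n) (norm n)" if "t - e < u" "u < t" for u
        using L_ball[of u m] that arc[of m] unfolding c n e_def bm Lt by auto
      show "L u \<in> ball (L t + n) (norm n)" if "t < u" "u < t + e" for u
        using L_ball[of u "m + 1"] that arc[of "m + 1"] unfolding d n e_def am Lt by auto
    qed (use L_leg in auto)
    ultimately show ?thesis using horizontal_direction[OF Lt tZ] by blast
  qed
qed

text \<open>With the same horizontal \<open>v\<close> for both curves, each stage of the homotopy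
  increases too, and two of its points with distinct close parameters are never on one vertical
  line. Near a corner \<open>w i\<close> serves; elsewhere the direction found at \<open>t\<close>
  persists by continuity of the derivatives.\<close>

lemma locally_increasing:
  "\<exists>v \<delta>. v $ 3 = 0 \<and> 0 < \<delta> \<and> (\<forall>x\<in>{t - \<delta><..<t + \<delta>}. \<forall>y\<in>{t - \<delta><..<t + \<delta>}. x < y \<longrightarrow>
      v \<bullet> K x < v \<bullet> K y \<and> v \<bullet> L x < v \<bullet> L y)"
proof (cases "\<exists>i. K t \<in> ball (K (of_int i)) r")
  case True
  then obtain i and m :: int where m: "t + of_int m * real k \<in> {a i<..<b i}"
    using near_corner_shift by metis
  let ?t = "t + of_int m * real k"
  show ?thesis
  proof (rule exI[of _ "w i"], rule exI[of _ "min (?t - a i) (b i - ?t)"], intro conjI ballI impI)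
    fix x y assume xy: "x \<in> {t - min (?t - a i) (b i - ?t)<..<t + min (?t - a i) (b i - ?t)}"
      "y \<in> {t - min (?t - a i) (b i - ?t)<..<t + min (?t - a i) (b i - ?t)}" "x < y"
    have "x + of_int m * real k \<in> {a i<..<b i}" "y + of_int m * real k \<in> {a i<..<b i}" using xy by auto
    from K_increasing[OF this] L_increasing[OF this]
    show "w i \<bullet> K x < w i \<bullet> K y" "w i \<bullet> L x < w i \<bullet> L y" using xy(3) by (simp_all add: K_shift L_shift)
  qed (use m w_horizontal in auto)
next
  case False
  then obtain v where v: "v $ 3 = 0" "0 < v \<bullet> K' t" "0 < v \<bullet> L' t" using common_direction[of t] by auto
  have tZ: "t \<notin> \<int>" using False Ints_near_corner by blast
  have "isCont K' t" "isCont L' t"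
    using K''[OF tZ] L''[of t] by (auto intro: has_vector_derivative_continuous)
  hence "isCont (\<lambda>u. v \<bullet> K' u) t" "isCont (\<lambda>u. v \<bullet> L' u) t" by (auto intro: continuous_intros)
  hence "((\<lambda>u. v \<bullet> K' u) \<longlongrightarrow> v \<bullet> K' t) (nhds t)" "((\<lambda>u. v \<bullet> L' u) \<longlongrightarrow> v \<bullet> L' t) (nhds t)"
    using tendsto_at_iff_tendsto_nhds[of "\<lambda>u. v \<bullet> K' u" t] tendsto_at_iff_tendsto_nhds[of "\<lambda>u. v \<bullet> L' u" t]
    by (simp_all add: isCont_def)
  hence "eventually (\<lambda>u. 0 < v \<bullet> K' u) (nhds t)" "eventually (\<lambda>u. 0 < v \<bullet> L' u) (nhds t)"
    using v by (simp_all only: order_tendstoD(1))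
  hence "eventually (\<lambda>u. 0 < v \<bullet> K' u \<and> 0 < v \<bullet> L' u) (nhds t)" by (rule eventually_conj)
  moreover have "eventually (\<lambda>u. u \<in> - \<int>) (nhds t)"
    using tZ by (intro eventually_nhds_in_open) (auto simp: open_Compl)
  ultimately have "eventually (\<lambda>u. 0 < v \<bullet> K' u \<and> 0 < v \<bullet> L' u \<and> u \<notin> \<int>) (nhds t)"
    by eventually_elim auto
  then obtain \<delta> where \<delta>: "0 < \<delta>" "\<And>u. dist u t < \<delta> \<Longrightarrow> 0 < v \<bullet> K' u \<and> 0 < v \<bullet> L' u \<and> u \<notin> \<int>"
    unfolding eventually_nhds_metric by blast
  show ?thesis
  proof (rule exI[of _ v], rule exI[of _ \<delta>], intro conjI ballI impI v(1) \<delta>(1))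
    fix x y assume xy: "x \<in> {t - \<delta><..<t + \<delta>}" "y \<in> {t - \<delta><..<t + \<delta>}" "x < y"
    have u: "0 < v \<bullet> K' u" "0 < v \<bullet> L' u" "u \<notin> \<int>" if "x \<le> u" "u \<le> y" for u
      using \<delta>(2)[of u] xy that by (auto simp: dist_real_def)
    show "v \<bullet> K x < v \<bullet> K y"
      by (rule DERIV_pos_imp_increasing[OF xy(3)])
         (metis u has_real_derivative_iff_has_vector_derivative
            bounded_linear.has_vector_derivative[OF bounded_linear_inner_right K'])
    show "v \<bullet> L x < v \<bullet> L y"
      by (rule DERIV_pos_imp_increasing[OF xy(3)])
         (metis u has_real_derivative_iff_has_vector_derivative
            bounded_linear.has_vector_derivative[OF bounded_linear_inner_right L'])
  qed
qed

lemma continuous_on_C: "continuous_on UNIV (\<lambda>p. C (fst p) (snd p))"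
proof -
  have L_cont: "continuous_on UNIV L"
    using L' by (auto intro!: continuous_at_imp_continuous_on has_vector_derivative_continuous)
  thus ?thesis unfolding C_def
    by (intro continuous_on_add continuous_on_scaleR continuous_on_diff continuous_on_const
        continuous_on_fst continuous_on_id continuous_on_compose2[OF K_cont continuous_on_snd[OF continuous_on_id]]
        continuous_on_compose2[OF L_cont continuous_on_snd[OF continuous_on_id]]) auto
qed

text \<open>A sequence of chords with lengths tending to 0 would have a limit at some stage
  \<open>s0\<close>. Embeddedness of this stage forces the two end points to have equal parameters
  up to a period, and then, late in the sequence, both ends lie where
  \<open>locally_increasing\<close> separates their horizontal positions, against
  verticality.\<close>

lemma no_short_vertical_chords:
  "\<exists>\<epsilon>\<^sub>0>0. \<forall>\<epsilon> s t u. 0 < \<epsilon> \<longrightarrow> \<epsilon> < \<epsilon>\<^sub>0 \<longrightarrow> s \<in> {0..1} \<longrightarrow> C s t \<noteq> C s u + \<epsilon> *\<^sub>R axis 3 1"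
proof (rule ccontr)
  assume no: "\<not> ?thesis"
  \<comment> \<open>Parameters are reduced to one period so that the triples
    \<open>(s, t, u)\<close> range over a compact box; the length of the chord is kept as a separate
    first component.\<close>
  define chord where "chord = (\<lambda>n p. 0 < fst p \<and> fst p < 1 / real (Suc n) \<and>
    snd p \<in> cbox (0, 0, 0) (1, real k, real k) \<and>
    C (fst (snd p)) (fst (snd (snd p))) = C (fst (snd p)) (snd (snd (snd p))) + fst p *\<^sub>R axis 3 1)"
  have "\<exists>p. chord n p" for n
  proof -
    have "\<exists>\<epsilon> s t u. 0 < \<epsilon> \<and> \<epsilon> < 1 / real (Suc n) \<and> s \<in> {0..1} \<and> C s t = C s u + \<epsilon> *\<^sub>R axis 3 1"
    proof (rule ccontr)
      assume "\<not> ?thesis"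
      hence "\<forall>\<epsilon> s t u. 0 < \<epsilon> \<longrightarrow> \<epsilon> < 1 / real (Suc n) \<longrightarrow> s \<in> {0..1} \<longrightarrow> C s t \<noteq> C s u + \<epsilon> *\<^sub>R axis 3 1"
        by blast
      moreover have "0 < 1 / real (Suc n)" by simp
      ultimately show False using no by blast
    qed
    then obtain \<epsilon> s t u where h: "0 < \<epsilon>" "\<epsilon> < 1 / real (Suc n)" "s \<in> {0..1}" "C s t = C s u + \<epsilon> *\<^sub>R axis 3 1"
      by blast
    obtain m :: int where m: "t + of_int m * real k \<in> {0..<0 + real k}" using ex_shift by blast
    obtain l :: int where l: "u + of_int l * real k \<in> {0..<0 + real k}" using ex_shift by blast
    show ?thesis
      by (rule exI[of _ "(\<epsilon>, s, t + of_int m * real k, u + of_int l * real k)"])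
         (use h m l in \<open>auto simp: chord_def C_shift cbox_Pair_iff\<close>)
  qed
  then obtain p where "\<And>n. chord n (p n)" using choice[of chord] by blast
  hence p: "\<And>n. 0 < fst (p n)" "\<And>n. fst (p n) < 1 / real (Suc n)"
    "\<And>n. snd (p n) \<in> cbox (0, 0, 0) (1, real k, real k)"
    "\<And>n. C (fst (snd (p n))) (fst (snd (snd (p n)))) =
       C (fst (snd (p n))) (snd (snd (snd (p n)))) + fst (p n) *\<^sub>R axis 3 1"
    unfolding chord_def by blast+
  have compact: "compact (cbox (0, 0, 0) (1::real, real k, real k))" by simp
  obtain q h where q: "q \<in> cbox (0, 0, 0) (1, real k, real k)" and h: "strict_mono h"
    and lim: "((\<lambda>n. snd (p n)) \<circ> h) \<longlonglongrightarrow> q"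
    by (rule seq_compactE[OF compact_imp_seq_compact[OF compact], of "\<lambda>n. snd (p n)"]) (use p(3) in auto)
  define s t u \<epsilon> where "s = (\<lambda>n. fst (snd (p (h n))))" and "t = (\<lambda>n. fst (snd (snd (p (h n)))))"
    and "u = (\<lambda>n. snd (snd (snd (p (h n)))))" and "\<epsilon> = (\<lambda>n. fst (p (h n)))"
  obtain s0 t0 u0 where q0: "q = (s0, t0, u0)" by (cases q)
  have s: "s n \<in> {0..1}" for n
    using p(3)[of "h n"] by (cases "snd (p (h n))") (simp add: s_def cbox_Pair_iff)
  have s0: "s0 \<in> {0..1}" using q by (auto simp: q0 cbox_Pair_iff)
  have eq: "C (s n) (t n) = C (s n) (u n) + \<epsilon> n *\<^sub>R axis 3 1" for n
    using p(4) by (simp add: s_def t_def u_def \<epsilon>_def)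
  have lims: "s \<longlonglongrightarrow> s0" "t \<longlonglongrightarrow> t0" "u \<longlonglongrightarrow> u0"
    using tendsto_fst[OF lim] tendsto_fst[OF tendsto_snd[OF lim]] tendsto_snd[OF tendsto_snd[OF lim]]
    by (simp_all add: q0 s_def t_def u_def comp_def)
  have "(\<lambda>n. fst (p n)) \<longlonglongrightarrow> 0"
    by (rule tendsto_sandwich[OF _ _ tendsto_const LIMSEQ_inverse_real_of_nat])
       (use p(1,2) in \<open>auto intro!: always_eventually less_imp_le simp: inverse_eq_divide\<close>)
  hence "\<epsilon> \<longlonglongrightarrow> 0" using LIMSEQ_subseq_LIMSEQ[OF _ h] by (auto simp: \<epsilon>_def comp_def)
  have limC: "(\<lambda>n. C (s n) (x n)) \<longlonglongrightarrow> C s0 x0" if "x \<longlonglongrightarrow> x0" for x x0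
    using continuous_on_tendsto_compose[OF continuous_on_C tendsto_Pair[OF lims(1) that]] by simp
  have "(\<lambda>n. C (s n) (u n) + \<epsilon> n *\<^sub>R axis 3 1) \<longlonglongrightarrow> C s0 u0 + 0 *\<^sub>R axis 3 1"
    by (intro tendsto_add tendsto_scaleR tendsto_const limC lims(3)) fact
  hence "(\<lambda>n. C (s n) (t n)) \<longlonglongrightarrow> C s0 u0 + 0 *\<^sub>R axis 3 1"
    by (simp only: eq)
  hence "C s0 t0 = C s0 u0 + 0 *\<^sub>R axis 3 1"
    by (rule LIMSEQ_unique[OF limC[OF lims(2)]])
  hence "C s0 t0 = C s0 u0" by simp
  then obtain m :: int where m: "t0 = u0 + of_int m * real k" using C_injective s0 by blast
  obtain v \<delta> where v: "v $ 3 = 0" and \<delta>: "0 < \<delta>" and inc: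
    "\<And>x y. x \<in> {t0 - \<delta><..<t0 + \<delta>} \<Longrightarrow> y \<in> {t0 - \<delta><..<t0 + \<delta>} \<Longrightarrow> x < y \<Longrightarrow>
      v \<bullet> K x < v \<bullet> K y \<and> v \<bullet> L x < v \<bullet> L y"
    using locally_increasing[of t0] by blast
  \<comment> \<open>The limits may differ by a multiple of the period, such as 0 and
    \<open>k\<close>, so \<open>u\<close> is shifted next to \<open>t0\<close>.\<close>
  have "(\<lambda>n. u n + of_int m * real k) \<longlonglongrightarrow> t0" unfolding m by (intro tendsto_intros lims)
  hence "eventually (\<lambda>n. u n + of_int m * real k \<in> {t0 - \<delta><..<t0 + \<delta>}) sequentially"
    using \<delta> by (intro topological_tendstoD) auto
  moreover have "eventually (\<lambda>n. t n \<in> {t0 - \<delta><..<t0 + \<delta>}) sequentially"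
    using lims(2) \<delta> by (intro topological_tendstoD) auto
  ultimately have "eventually (\<lambda>n. u n + of_int m * real k \<in> {t0 - \<delta><..<t0 + \<delta>} \<and> t n \<in> {t0 - \<delta><..<t0 + \<delta>}) sequentially"
    by eventually_elim auto
  then obtain n where n: "u n + of_int m * real k \<in> {t0 - \<delta><..<t0 + \<delta>}" "t n \<in> {t0 - \<delta><..<t0 + \<delta>}"
    by (auto dest: eventually_happens)
  have "v \<bullet> axis 3 1 = 0" using v by (simp add: inner_axis)
  hence "v \<bullet> C (s n) (t n) = v \<bullet> C (s n) (u n + of_int m * real k)"
    using eq[of n] by (simp add: C_shift inner_add_right)
  hence "t n = u n + of_int m * real k"
    using C_increasing[OF _ _ s[of n], of v] inc n by (metis less_irrefl linorder_neqE_linordered_idom)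
  hence "C (s n) (t n) = C (s n) (u n)" by (simp add: C_shift)
  hence "\<epsilon> n = 0" using eq[of n] by (simp add: axis_eq_0_iff)
  thus False using p(1)[of "h n"] by (simp add: \<epsilon>_def)
qed

end

section \<open>Cycles of the Petersen graph\<close>

text \<open>Oriented edges of the closed walk. As a set they represent the oriented cycle: the
  starting vertex drops out, and reversal becomes \<open>prod.swap\<close>.\<close>

definition darts :: "'v list \<Rightarrow> ('v \<times> 'v) list" where
  "darts vs = zip vs (rotate1 vs)"

lemma length_darts [simp]: "length (darts vs) = length vs"
  by (simp add: darts_def)

lemma nth_darts: "i < length vs \<Longrightarrow> darts vs ! i = (vs ! i, vs ! (Suc i mod length vs))"
  by (simp add: darts_def nth_rotate1)

lemma darts_conv_nth: "set (darts vs) = {(vs ! i, vs ! (Suc i mod length vs)) | i. i < length vs}"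
  by (auto simp: set_conv_nth nth_darts) (metis nth_darts)

lemma distinct_darts: "distinct vs \<Longrightarrow> distinct (darts vs)"
  by (simp add: darts_def distinct_zipI1)

lemma set_darts_map: "set (darts (map f vs)) = map_prod f f ` set (darts vs)"
  by (simp add: darts_def rotate1_map zip_map_map map_prod_def)

lemma zip_rotate1: "length xs = length ys \<Longrightarrow> zip (rotate1 xs) (rotate1 ys) = rotate1 (zip xs ys)"
  by (cases xs; cases ys) auto

lemma set_darts_rotate [simp]: "set (darts (rotate n vs)) = set (darts vs)"
proof -
  have "darts (rotate1 xs) = rotate1 (darts xs)" for xs :: "'a list"
    by (simp add: darts_def zip_rotate1)
  hence "set (darts (rotate1 xs)) = set (darts xs)" for xs :: "'a list" by simp
  thus ?thesis by (induction n) simp_all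
qed

lemma set_darts_rev [simp]: "set (darts (rev vs)) = prod.swap ` set (darts vs)"
proof (cases vs rule: rev_cases)
  case (snoc xs x)
  have "darts (rev vs) = zip (rev (rotate1 (x # xs))) (rev (x # xs))"
    using snoc by (simp add: darts_def)
  also have "\<dots> = rev (zip (rotate1 (x # xs)) (x # xs))" by (rule zip_rev) simp
  also have "set \<dots> = prod.swap ` set (darts (x # xs))"
    unfolding darts_def by (subst zip_commute) (force simp: image_iff)
  also have "set (darts (x # xs)) = set (darts (rotate 1 (x # xs)))" by (rule set_darts_rotate[symmetric])
  also have "rotate 1 (x # xs) = vs" using snoc by simp
  finally show ?thesis .
qed (simp add: darts_def)

definition dart_edge :: "'v \<times> 'v \<Rightarrow> 'v set" where "dart_edge = (\<lambda>(x, y). {x, y})"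

lemma dart_edge_simps [simp]: "dart_edge (x, y) = {x, y}" "dart_edge (prod.swap d) = dart_edge d"
  by (auto simp: dart_edge_def case_prod_unfold)

lemma traces_cycle_darts:
  "traces_cycle E vs \<gamma> \<longleftrightarrow>
     3 \<le> length vs \<and> distinct vs \<and> \<gamma> \<subseteq> E \<and> \<gamma> = dart_edge ` set (darts vs)"
proof -
  have "dart_edge ` set (darts vs) = {{vs ! i, vs ! (Suc i mod length vs)} | i. i < length vs}"
    unfolding darts_conv_nth dart_edge_def by auto
  thus ?thesis by (simp add: traces_cycle_def)
qed

text \<open>Two opposite darts would make each of two positions the cyclic successor of the other,
  which happens only in length at most 2. Hence a cycle runs through each of its edges in one
  direction only.\<close>

lemma darts_asym:
  assumes "distinct vs" "3 \<le> length vs" "(x, y) \<in> set (darts vs)"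
  shows "(y, x) \<notin> set (darts vs)"
proof
  let ?k = "length vs"
  assume "(y, x) \<in> set (darts vs)"
  then obtain i j where ij: "i < ?k" "j < ?k" "x = vs ! i" "y = vs ! (Suc i mod ?k)"
    "y = vs ! j" "x = vs ! (Suc j mod ?k)"
    using assms(3) unfolding darts_conv_nth by blast
  have k: "0 < ?k" using assms(2) by linarith
  have "Suc i mod ?k = j" "Suc j mod ?k = i"
    using ij assms(1) nth_eq_iff_index_eq[of vs] mod_less_divisor[OF k] by metis+
  thus False using ij(1,2) assms(2)
    by (cases "Suc i = ?k"; cases "Suc j = ?k") auto
qed

lemma card_traces_cycle:
  assumes "traces_cycle E vs \<gamma>"
  shows "card \<gamma> = length vs"
proof -
  have vs: "3 \<le> length vs" "distinct vs" "\<gamma> = dart_edge ` set (darts vs)"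
    using assms by (auto simp: traces_cycle_darts)
  have "inj_on dart_edge (set (darts vs))"
    unfolding inj_on_def dart_edge_def by (auto simp: doubleton_eq_iff dest: darts_asym[OF vs(2,1)])
  thus ?thesis by (simp add: vs(3) card_image distinct_card[OF distinct_darts[OF vs(2)]])
qed

text \<open>The bilinear form with entries \<open>G\<close> on pairs of darts, evaluated with the
  oriented cycle in both arguments.\<close>

definition dart_sum :: "('v \<times> 'v \<Rightarrow> 'v \<times> 'v \<Rightarrow> real) \<Rightarrow> 'v list \<Rightarrow> real" where
  "dart_sum G vs = (\<Sum>d\<in>set (darts vs). \<Sum>d'\<in>set (darts vs). G d d')"

lemma dart_sum_conv_nth:
  assumes "distinct vs"
  shows "dart_sum G vs = (\<Sum>i<length vs. \<Sum>j<length vs.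
     G (vs ! i, vs ! (Suc i mod length vs)) (vs ! j, vs ! (Suc j mod length vs)))"
proof -
  have *: "(\<Sum>d\<in>set (darts vs). h d) = (\<Sum>i<length vs. h (vs ! i, vs ! (Suc i mod length vs)))"
    for h :: "'a \<times> 'a \<Rightarrow> real"
  proof -
    have "(\<Sum>d\<in>set (darts vs). h d) = sum_list (map h (darts vs))"
      by (rule sum_list_distinct_conv_sum_set[symmetric, OF distinct_darts[OF assms]])
    also have "\<dots> = (\<Sum>i<length vs. h (vs ! i, vs ! (Suc i mod length vs)))"
      by (simp add: sum_list_sum_nth nth_darts atLeast0LessThan)
    finally show ?thesis .
  qed
  show ?thesis by (simp add: dart_sum_def *)
qed

section \<open>The Petersen graph on the numbers 0 to 9\<close>

definition pg_vertex :: "nat \<Rightarrow> petersen_vertex" where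
  "pg_vertex n = [PG_u 0, PG_u 1, PG_u 2, PG_u 3, PG_u 4, PG_v 0, PG_v 1, PG_v 2, PG_v 3, PG_v 4] ! n"

definition pg_nbrs :: "nat \<Rightarrow> nat list" where
  "pg_nbrs x =
     [[1,4,5],[0,2,6],[1,3,7],[2,4,8],[3,0,9],[0,7,8],[1,8,9],[2,5,9],[3,5,6],[4,6,7]] ! x"

text \<open>One orientation for each of the 15 edges, from the smaller number to the larger: the
  basis in which chains are written.\<close>

definition pg_darts :: "(nat \<times> nat) list" where
  "pg_darts = [(0,1),(0,4),(0,5),(1,2),(1,6),(2,3),(2,7),(3,4),(3,8),(4,9),(5,7),(5,8),(6,8),(6,9),(7,9)]"

lemma mod5_cases: "i = 0 \<or> i = 1 \<or> i = 2 \<or> i = 3 \<or> i = 4" for i :: 5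
proof -
  obtain z where z: "i = of_int z" "0 \<le> z" "z < 5" by (cases i rule: bit1_cases) auto
  hence "z = 0 \<or> z = 1 \<or> z = 2 \<or> z = 3 \<or> z = 4" by auto
  thus ?thesis using z(1) by auto
qed

lemma all_less_10: "(\<forall>n<10. P n) \<longleftrightarrow> P 0 \<and> P 1 \<and> P 2 \<and> P 3 \<and> P 4 \<and> P 5 \<and> P 6 \<and> P 7 \<and> P 8 \<and> P (9::nat)"
  by (simp add: numeral_eq_Suc All_less_Suc) blast

lemma pg_vertex_bij: "bij_betw pg_vertex {..<10} UNIV"
proof (rule bij_betw_imageI)
  have "\<forall>m<10. \<forall>n<10. pg_vertex m = pg_vertex n \<longrightarrow> m = n"
    unfolding all_less_10 by (simp add: pg_vertex_def)
  thus "inj_on pg_vertex {..<10}" by (auto simp: inj_on_def)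
  have "x \<in> pg_vertex ` {..<10}" for x
  proof -
    have "\<exists>n<10. x = pg_vertex n"
    proof (rule ccontr)
      assume "\<not> ?thesis"
      hence *: "\<forall>n<10. x \<noteq> pg_vertex n" by blast
      show False
      proof (cases x)
        case (PG_u i)
        thus False using * mod5_cases[of i] unfolding all_less_10 by (simp add: pg_vertex_def)
      next
        case (PG_v i)
        thus False using * mod5_cases[of i] unfolding all_less_10 by (simp add: pg_vertex_def)
      qed
    qed
    thus ?thesis by auto
  qed
  thus "pg_vertex ` {..<10} = UNIV" by auto
qed

lemma pg_edge_iff_nbrs:
  assumes "x < 10" "y < 10"
  shows "{pg_vertex x, pg_vertex y} \<in> petersen_edges \<longleftrightarrow> x \<in> set (pg_nbrs y)"
proof -
  have E: "petersen_edges = (\<lambda>i. {PG_u i, PG_u (i + 1)}) ` {0,1,2,3,4} \<union>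
      (\<lambda>i. {PG_u i, PG_v i}) ` {0,1,2,3,4} \<union> (\<lambda>i. {PG_v i, PG_v (i + 2)}) ` {0,1,2,3,4}"
    using mod5_cases unfolding petersen_edges_def by blast
  have "\<forall>x<10. \<forall>y<10. {pg_vertex x, pg_vertex y} \<in> petersen_edges \<longleftrightarrow> x \<in> set (pg_nbrs y)"
    unfolding all_less_10 E by (simp add: pg_vertex_def pg_nbrs_def doubleton_eq_iff)
  thus ?thesis using assms by blast
qed

lemma pg_nbrs_iff_darts:
  assumes "x < 10" "y < 10"
  shows "x \<in> set (pg_nbrs y) \<longleftrightarrow> (x, y) \<in> set pg_darts \<or> (y, x) \<in> set pg_darts"
proof -
  have "\<forall>x<10. \<forall>y<10. x \<in> set (pg_nbrs y) \<longleftrightarrow> (x, y) \<in> set pg_darts \<or> (y, x) \<in> set pg_darts"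
    unfolding all_less_10 by (simp add: pg_darts_def pg_nbrs_def)
  thus ?thesis using assms by blast
qed

lemma pg_nbrs_less: "x \<in> set (pg_nbrs y) \<Longrightarrow> y < 10 \<Longrightarrow> x < 10"
proof -
  have "\<forall>y<10. \<forall>x\<in>set (pg_nbrs y). x < 10" unfolding all_less_10 by (simp add: pg_nbrs_def)
  thus "x \<in> set (pg_nbrs y) \<Longrightarrow> y < 10 \<Longrightarrow> x < 10" by blast
qed

fun pg_walks :: "nat \<Rightarrow> nat \<Rightarrow> nat list list" where
  "pg_walks s 0 = [[s]]"
| "pg_walks s (Suc n) = concat (map (\<lambda>p. map (\<lambda>x. x # p)
     (filter (\<lambda>x. s < x \<and> x \<notin> set p) (pg_nbrs (hd p)))) (pg_walks s n))"

text \<open>Each \<open>k\<close>-cycle is listed once: it ends at its least vertex, and of its two orientations the one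
  whose first vertex is below the last but one is chosen.\<close>

definition pg_cycles :: "nat \<Rightarrow> nat list list" where
  "pg_cycles k = concat (map (\<lambda>s. filter (\<lambda>p. hd p \<in> set (pg_nbrs s) \<and> hd p < last (butlast p))
     (pg_walks s (k - 1))) [0..<10])"

text \<open>The cycle as a 1-chain in the basis \<open>pg_darts\<close>, signed by
  orientation.\<close>

definition pg_chain :: "nat list \<Rightarrow> int list" where
  "pg_chain p = (let ds = darts p in
     map (\<lambda>d. if d \<in> set ds then 1 else if prod.swap d \<in> set ds then -1 else 0) pg_darts)"

text \<open>The matrix of the tensor obtained by summing \<open>c\<close> \<otimes> \<open>c\<close>
  over the list, that is, the product of the transposed chain matrix with the chain matrix, built up
  by rank-one updates.\<close>

fun gram :: "nat \<Rightarrow> int list list \<Rightarrow> int list list" where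
  "gram n [] = replicate n (replicate n 0)"
| "gram n (c # cs) = map2 (\<lambda>x row. map2 (\<lambda>y m. x * y + m) c row) c (gram n cs)"

text \<open>By exhaustive search: girth 5, no 7-cycle and no Hamiltonian cycle. Only the lengths 5,
  6, 8 and 9 remain.\<close>

lemma pg_cycles_empty: "pg_cycles 3 = []" "pg_cycles 4 = []" "pg_cycles 7 = []" "pg_cycles 10 = []"
  by code_simp+

text \<open>The absolute values form the indicator vector of the edge set, so this checks that the
  enumeration lists no cycle twice.\<close>

lemma pg_chains_distinct:
  "distinct (map (\<lambda>p. map abs (pg_chain p)) (pg_cycles 5))"
  "distinct (map (\<lambda>p. map abs (pg_chain p)) (pg_cycles 6))"
  "distinct (map (\<lambda>p. map abs (pg_chain p)) (pg_cycles 8))"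
  "distinct (map (\<lambda>p. map abs (pg_chain p)) (pg_cycles 9))"
  by code_simp+

text \<open>In \<open>H\<^sub>1 \<otimes> H\<^sub>1\<close> the sum of \<open>\<gamma> \<otimes> \<gamma>\<close> over all \<open>k\<close>-cycles is invariant under the automorphism
  group, so that these sums are proportional, with factors given by their traces \<open>12 \<cdot> 5\<close>, \<open>10 \<cdot> 6\<close>,
  \<open>15 \<cdot> 8\<close> and \<open>20 \<cdot> 9\<close>. Here the proportionality is read off from the matrices.\<close>

lemma pg_gram:
  "gram 15 (map pg_chain (pg_cycles 6)) = gram 15 (map pg_chain (pg_cycles 5))"
  "gram 15 (map pg_chain (pg_cycles 8)) = map (map (\<lambda>m. 2 * m)) (gram 15 (map pg_chain (pg_cycles 5)))"
  "gram 15 (map pg_chain (pg_cycles 9)) = map (map (\<lambda>m. 3 * m)) (gram 15 (map pg_chain (pg_cycles 5)))"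
  by code_simp+

lemma gram_length:
  assumes "\<forall>c\<in>set cs. length c = n"
  shows "length (gram n cs) = n \<and> (\<forall>i<n. length (gram n cs ! i) = n)"
  using assms by (induction cs) auto

lemma gram_sum:
  fixes g :: "nat \<Rightarrow> nat \<Rightarrow> real"
  assumes "\<forall>c\<in>set cs. length c = n"
  shows "(\<Sum>c\<leftarrow>cs. \<Sum>i<n. \<Sum>j<n. of_int (c ! i) * of_int (c ! j) * g i j) =
    (\<Sum>i<n. \<Sum>j<n. of_int (gram n cs ! i ! j) * g i j)"
  using assms
proof (induction cs)
  case (Cons c cs)
  have l: "length c = n" "length (gram n cs) = n" "\<And>i. i < n \<Longrightarrow> length (gram n cs ! i) = n"
    using Cons.prems gram_length[of cs n] by auto
  have "gram n (c # cs) ! i ! j = c ! i * c ! j + gram n cs ! i ! j" if "i < n" "j < n" for i j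
    using that l by simp
  hence "(\<Sum>i<n. \<Sum>j<n. of_int (gram n (c # cs) ! i ! j) * g i j) =
      (\<Sum>i<n. \<Sum>j<n. of_int (c ! i) * of_int (c ! j) * g i j + of_int (gram n cs ! i ! j) * g i j)"
    by (intro sum.cong refl) (simp add: algebra_simps del: gram.simps)
  thus ?case using Cons by (simp add: sum.distrib del: gram.simps)
qed simp

section \<open>Correctness of the enumeration\<close>

lemma pg_walks_iff:
  "p \<in> set (pg_walks s n) \<longleftrightarrow> length p = Suc n \<and> distinct p \<and> last p = s \<and>
     (\<forall>x\<in>set (butlast p). s < x) \<and> successively (\<lambda>x y. x \<in> set (pg_nbrs y)) p"
proof (induction n arbitrary: p)
  case 0
  show ?case by (cases p) (auto simp: length_Suc_conv)
next
  case (Suc n)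
  show ?case
  proof (cases p)
    case (Cons x q)
    have "p \<in> set (pg_walks s (Suc n)) \<longleftrightarrow>
        q \<in> set (pg_walks s n) \<and> s < x \<and> x \<notin> set q \<and> x \<in> set (pg_nbrs (hd q))"
      by (auto simp: Cons)
    thus ?thesis unfolding Suc.IH by (cases "q = []") (auto simp: Cons successively_Cons)
  qed auto
qed

definition pg_edges :: "nat list \<Rightarrow> petersen_vertex set set" where
  "pg_edges p = dart_edge ` set (darts (map pg_vertex p))"

lemma darts_successively:
  assumes "p \<noteq> []"
  shows "(\<forall>(x, y)\<in>set (darts p). P x y) \<longleftrightarrow> successively P p \<and> P (last p) (hd p)"
proof -
  have *: "(\<forall>(a, b)\<in>set (zip (x # xs) (xs @ [z])). P a b) \<longleftrightarrow> successively P (x # xs) \<and> P (last (x # xs)) z"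
    for x z xs
    by (induction xs arbitrary: x) auto
  obtain x xs where "p = x # xs" using assms by (cases p) auto
  thus ?thesis using *[of x xs x] by (simp add: darts_def)
qed

lemma pg_nbrs_sym: "x < 10 \<Longrightarrow> y < 10 \<Longrightarrow> x \<in> set (pg_nbrs y) \<longleftrightarrow> y \<in> set (pg_nbrs x)"
  by (auto simp: pg_nbrs_iff_darts)

lemma walk_less_10:
  assumes "successively (\<lambda>x y. x \<in> set (pg_nbrs y)) p" "p \<noteq> []" "last p < 10"
  shows "set p \<subseteq> {..<10}"
  using assms
proof (induction p)
  case (Cons x p)
  show ?case
  proof (cases "p = []")
    case False
    hence "set p \<subseteq> {..<10}" "x \<in> set (pg_nbrs (hd p))" using Cons by (auto simp: successively_Cons)
    thus ?thesis using False pg_nbrs_less[of x "hd p"] by (auto simp: subset_iff)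
  qed (use Cons in auto)
qed simp

lemma pg_cycles_iff:
  assumes "1 \<le> k"
  shows "p \<in> set (pg_cycles k) \<longleftrightarrow> length p = k \<and> distinct p \<and> set p \<subseteq> {..<10} \<and>
    (\<forall>(x, y)\<in>set (darts p). x \<in> set (pg_nbrs y)) \<and> (\<forall>x\<in>set (butlast p). last p < x) \<and>
    hd p < last (butlast p)" (is "_ \<longleftrightarrow> ?R")
proof
  assume "p \<in> set (pg_cycles k)"
  then obtain s where s: "s < 10" "p \<in> set (pg_walks s (k - 1))" "hd p \<in> set (pg_nbrs s)"
    "hd p < last (butlast p)"
    by (auto simp: pg_cycles_def)
  note w = s(2)[unfolded pg_walks_iff]
  have ne: "p \<noteq> []" using w by auto
  have sub: "set p \<subseteq> {..<10}" using w s(1) ne by (intro walk_less_10) auto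
  \<comment> \<open>The search tests \<open>hd p\<close> against the neighbours of \<open>s\<close>,
    while the closing dart leads from \<open>s\<close> to \<open>hd p\<close>.\<close>
  hence "s \<in> set (pg_nbrs (hd p))"
    using s(1,3) ne pg_nbrs_sym[of "hd p" s] by (auto simp: subset_iff)
  thus ?R using w s sub ne assms by (simp add: darts_successively)
next
  assume R: ?R
  have ne: "p \<noteq> []" using R assms by auto
  have "last p < 10" "hd p < 10" using R ne by (auto simp: subset_iff)
  moreover have "successively (\<lambda>x y. x \<in> set (pg_nbrs y)) p" "last p \<in> set (pg_nbrs (hd p))"
    using R darts_successively[OF ne, of "\<lambda>x y. x \<in> set (pg_nbrs y)"] by auto
  ultimately show "p \<in> set (pg_cycles k)"
    unfolding pg_cycles_def using R assms pg_nbrs_sym[of "hd p" "last p"]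
    by (auto simp: pg_walks_iff intro!: bexI[of _ "last p"])
qed

lemma pg_vertex_inj: "x < 10 \<Longrightarrow> y < 10 \<Longrightarrow> pg_vertex x = pg_vertex y \<longleftrightarrow> x = y"
  using pg_vertex_bij by (auto simp: bij_betw_def inj_on_def)

lemma darts_subset: "set (darts p) \<subseteq> set p \<times> set p"
  unfolding darts_def by (auto dest: set_zip_leftD set_zip_rightD)

lemma pg_cycles_trace:
  assumes k: "3 \<le> k" and p: "p \<in> set (pg_cycles k)"
  shows "traces_cycle petersen_edges (map pg_vertex p) (pg_edges p)" "length p = k"
proof -
  have k1: "1 \<le> k" using k by simp
  note R = p[unfolded pg_cycles_iff[OF k1]]
  show "length p = k" using R by simp
  have "inj_on pg_vertex (set p)"
    using R pg_vertex_bij by (auto simp: bij_betw_def intro: inj_on_subset)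
  moreover have "pg_edges p \<subseteq> petersen_edges"
  proof -
    have "{pg_vertex x, pg_vertex y} \<in> petersen_edges" if "(x, y) \<in> set (darts p)" for x y
      using that R darts_subset[of p] by (subst pg_edge_iff_nbrs) (auto simp: subset_iff)
    thus ?thesis by (auto simp: pg_edges_def set_darts_map)
  qed
  ultimately show "traces_cycle petersen_edges (map pg_vertex p) (pg_edges p)"
    unfolding traces_cycle_darts using R k by (auto simp: pg_edges_def distinct_map)
qed

text \<open>A tracing may start anywhere and run either way. Rotation moves the least number to the
  end, reversal of the rest corrects the direction, and the dart set changes at most by a global
  swap.\<close>

lemma canonical_tracing:
  assumes tr: "traces_cycle petersen_edges vs \<gamma>"
  shows "\<exists>p\<in>set (pg_cycles (length vs)). \<gamma> = pg_edges p \<and>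
    (set (darts (map pg_vertex p)) = set (darts vs) \<or>
     set (darts (map pg_vertex p)) = prod.swap ` set (darts vs))"
proof -
  let ?g = "inv_into {..<10} pg_vertex"
  define p0 where "p0 = map ?g vs"
  note vs = tr[unfolded traces_cycle_darts]
  have g: "?g x < 10" "pg_vertex (?g x) = x" for x
    using pg_vertex_bij inv_into_into[of x pg_vertex "{..<10}"] by (auto simp: bij_betw_def f_inv_into_f)
  have p0: "map pg_vertex p0 = vs" "set p0 \<subseteq> {..<10}" "length p0 = length vs"
    using g by (auto simp: p0_def comp_def)
  have dp0: "distinct p0" using p0(1) vs by (metis distinct_map)
  have ne: "p0 \<noteq> []" using p0 vs by auto
  define s where "s = Min (set p0)"
  have "s \<in> set p0" using ne by (simp add: s_def)
  then obtain as bs where "p0 = as @ s # bs" by (meson split_list)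
  hence p0s: "p0 = (as @ [s]) @ bs" by simp
  define q where "q = bs @ as"
  have rot: "rotate (length (as @ [s])) p0 = q @ [s]"
    unfolding p0s q_def by (subst rotate_append) simp
  have q: "distinct (q @ [s])" "length (q @ [s]) = length vs" "set (q @ [s]) = set p0"
    using dp0 p0(3) by (auto simp: p0s q_def)
  have "s \<le> x" if "x \<in> set p0" for x using that by (simp add: s_def)
  hence less: "\<forall>x\<in>set q. s < x" using q by (force simp: le_less)
  have q2: "2 \<le> length q" using q(2) vs by auto
  \<comment> \<open>A cycle has at least three vertices, so the two neighbours of \<open>s\<close>
    on it are distinct and exactly one direction passes the strict test.\<close>
  have hl: "hd q \<noteq> last q"
    using q(1) q2 by (cases q) (auto simp: last_in_set)
  have eq: "set (darts (map pg_vertex (q @ [s]))) = set (darts vs)"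
    unfolding rot[symmetric] rotate_map[symmetric] p0(1) by (rule set_darts_rotate)
  have main: "p \<in> set (pg_cycles (length vs)) \<and> \<gamma> = pg_edges p"
    if p: "length p = length vs" "distinct p" "set p = set p0" "\<forall>x\<in>set (butlast p). last p < x"
      "hd p < last (butlast p)"
      and d: "set (darts (map pg_vertex p)) = set (darts vs) \<or>
        set (darts (map pg_vertex p)) = prod.swap ` set (darts vs)" for p
  proof
    show \<gamma>: "\<gamma> = pg_edges p"
    proof -
      have "dart_edge ` prod.swap ` A = dart_edge ` A" for A :: "(petersen_vertex \<times> petersen_vertex) set"
        by (simp only: image_image dart_edge_simps)
      thus ?thesis using d vs by (metis pg_edges_def)
    qed
    have "x \<in> set (pg_nbrs y)" if xy: "(x, y) \<in> set (darts p)" for x y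
    proof -
      have "{pg_vertex x, pg_vertex y} \<in> pg_edges p"
        using imageI[OF imageI[OF xy], of dart_edge "map_prod pg_vertex pg_vertex"]
        by (simp add: pg_edges_def set_darts_map)
      hence "{pg_vertex x, pg_vertex y} \<in> petersen_edges" using \<gamma> vs by auto
      moreover have "x < 10" "y < 10" using xy darts_subset[of p] p(3) p0(2) by auto
      ultimately show ?thesis by (simp add: pg_edge_iff_nbrs)
    qed
    thus "p \<in> set (pg_cycles (length vs))"
      using p p0(2) vs by (subst pg_cycles_iff) auto
  qed
  show ?thesis
  proof (cases "hd q < last q")
    case True
    have "hd (q @ [s]) = hd q" using q2 by (cases q) auto
    thus ?thesis using main[of "q @ [s]"] q less True eq by auto
  next
    case False
    define q' where "q' = rev q @ [s]"
    have q': "q' = rotate 1 (rev (q @ [s]))" by (simp add: q'_def)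
    have "set (darts (map pg_vertex q')) = prod.swap ` set (darts vs)"
      unfolding q' rotate_map[symmetric] rev_map[symmetric] set_darts_rotate set_darts_rev eq ..
    moreover have "hd q' = last q" "last (butlast q') = hd q"
      using q2 by (auto simp: q'_def butlast_append hd_append hd_rev last_rev)
    ultimately show ?thesis using main[of q'] q less False hl by (auto simp: q'_def)
  qed
qed

lemma pg_darts_props: "distinct pg_darts" "length pg_darts = 15" "(x, y) \<in> set pg_darts \<Longrightarrow> x < y \<and> y < 10"
  by (auto simp: pg_darts_def)

lemma pg_chain_length [simp]: "length (pg_chain p) = 15"
  by (simp add: pg_chain_def Let_def pg_darts_props(2))

lemma pg_chain_nth:
  "i < 15 \<Longrightarrow> pg_chain p ! i = (if pg_darts ! i \<in> set (darts p) then 1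
     else if prod.swap (pg_darts ! i) \<in> set (darts p) then -1 else 0)"
  by (simp add: pg_chain_def Let_def pg_darts_props(2))

abbreviation pg_dart :: "nat \<times> nat \<Rightarrow> petersen_vertex \<times> petersen_vertex" where
  "pg_dart \<equiv> map_prod pg_vertex pg_vertex"

lemma abs_pg_chain:
  assumes k: "3 \<le> k" and p: "p \<in> set (pg_cycles k)"
  shows "map abs (pg_chain p) = map (\<lambda>d. if dart_edge (pg_dart d) \<in> pg_edges p then 1 else 0) pg_darts"
proof (rule nth_equalityI)
  fix i assume "i < length (map abs (pg_chain p))"
  hence i: "i < 15" by simp
  obtain x y where xy: "pg_darts ! i = (x, y)" by (cases "pg_darts ! i")
  hence less: "x < 10" "y < 10" using pg_darts_props i by (metis nth_mem order.strict_trans)+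
  have "set p \<subseteq> {..<10}" using p k by (simp add: pg_cycles_iff)
  hence sub: "a < 10 \<and> b < 10" if "(a, b) \<in> set (darts p)" for a b
    using that darts_subset[of p] by auto
  have "{pg_vertex x, pg_vertex y} \<in> pg_edges p \<longleftrightarrow> (x, y) \<in> set (darts p) \<or> (y, x) \<in> set (darts p)"
  proof
    assume "{pg_vertex x, pg_vertex y} \<in> pg_edges p"
    then obtain a b where "(a, b) \<in> set (darts p)" "{pg_vertex x, pg_vertex y} = {pg_vertex a, pg_vertex b}"
      by (auto simp: pg_edges_def set_darts_map)
    thus "(x, y) \<in> set (darts p) \<or> (y, x) \<in> set (darts p)"
      using sub[of a b] less by (auto simp: doubleton_eq_iff pg_vertex_inj)
  next
    show "(x, y) \<in> set (darts p) \<or> (y, x) \<in> set (darts p) \<Longrightarrow> {pg_vertex x, pg_vertex y} \<in> pg_edges p"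
      by (force simp: pg_edges_def set_darts_map insert_commute)
  qed
  thus "map abs (pg_chain p) ! i =
      map (\<lambda>d. if dart_edge (pg_dart d) \<in> pg_edges p then 1 else 0) pg_darts ! i"
    using i xy by (simp add: pg_chain_nth pg_darts_props)
qed (simp add: pg_darts_props)

lemma pg_cycles_bij:
  assumes k: "3 \<le> k" and dist: "distinct (map (\<lambda>p. map abs (pg_chain p)) (pg_cycles k))"
  shows "bij_betw pg_edges (set (pg_cycles k)) (k_cycles k petersen_edges)"
proof (rule bij_betw_imageI)
  show "inj_on pg_edges (set (pg_cycles k))"
  proof (rule inj_onI)
    fix p q assume pq: "p \<in> set (pg_cycles k)" "q \<in> set (pg_cycles k)" "pg_edges p = pg_edges q"
    have "map abs (pg_chain p) = map abs (pg_chain q)"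
      unfolding abs_pg_chain[OF k pq(1)] abs_pg_chain[OF k pq(2)] pq(3) ..
    moreover have "inj_on (\<lambda>p. map abs (pg_chain p)) (set (pg_cycles k))"
      using dist by (simp only: distinct_map)
    ultimately show "p = q" using pq(1,2) by (blast dest: inj_onD)
  qed
  show "pg_edges ` set (pg_cycles k) = k_cycles k petersen_edges"
  proof (intro equalityI subsetI)
    fix \<gamma> assume "\<gamma> \<in> pg_edges ` set (pg_cycles k)"
    then obtain p where "p \<in> set (pg_cycles k)" "\<gamma> = pg_edges p" by auto
    thus "\<gamma> \<in> k_cycles k petersen_edges"
      using pg_cycles_trace[OF k, of p] card_traces_cycle[of petersen_edges "map pg_vertex p" \<gamma>]
      by (auto simp: k_cycles_def cycles_def)
  next
    fix \<gamma> assume "\<gamma> \<in> k_cycles k petersen_edges"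
    then obtain vs where vs: "traces_cycle petersen_edges vs \<gamma>" and "card \<gamma> = k"
      by (auto simp: k_cycles_def cycles_def)
    hence "length vs = k" using card_traces_cycle by metis
    thus "\<gamma> \<in> pg_edges ` set (pg_cycles k)" using canonical_tracing[OF vs] by blast
  qed
qed

text \<open>Since \<open>g\<close> changes sign with the direction, a dart against the chosen
  orientation contributes like its reverse with coefficient -1. The sum over darts thus becomes the
  pairing of \<open>g\<close> with the chain.\<close>

lemma pg_chain_sum:
  fixes g :: "petersen_vertex \<times> petersen_vertex \<Rightarrow> real"
  assumes k: "3 \<le> k" and p: "p \<in> set (pg_cycles k)"
    and g: "\<And>d. dart_edge d \<in> petersen_edges \<Longrightarrow> g (prod.swap d) = - g d"
  shows "(\<Sum>d\<in>set (darts (map pg_vertex p)). g d) = (\<Sum>i<15. of_int (pg_chain p ! i) * g (pg_dart (pg_darts ! i)))"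
proof -
  let ?D = "set (darts p)" and ?O = "set pg_darts"
  have k1: "1 \<le> k" using k by simp
  note R = p[unfolded pg_cycles_iff[OF k1]]
  have sub: "x < 10 \<and> y < 10" if "(x, y) \<in> ?D" for x y
    using that darts_subset[of p] R by auto
  have inj: "inj_on pg_dart ?D"
  proof (rule inj_onI)
    fix c d assume cd: "c \<in> ?D" "d \<in> ?D" "pg_dart c = pg_dart d"
    obtain x y x' y' where "c = (x, y)" "d = (x', y')" by (cases c; cases d)
    thus "c = d" using cd sub[of x y] sub[of x' y'] by (simp add: pg_vertex_inj)
  qed
  have dp: "distinct p" "3 \<le> length p" using R k by blast+
  have asym: "prod.swap d \<notin> ?D" if "d \<in> ?D" for d
    using that darts_asym[OF dp, of "fst d" "snd d"] by (simp add: prod.swap_def)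
  have cover: "d \<in> ?O \<or> prod.swap d \<in> ?O" if "d \<in> ?D" for d
  proof -
    obtain x y where xy: "d = (x, y)" by (cases d)
    hence "x \<in> set (pg_nbrs y)" using that R by blast
    thus ?thesis using that sub[of x y] xy by (simp add: pg_nbrs_iff_darts)
  qed
  have Oasym: "prod.swap d \<notin> ?O" if "d \<in> ?O" for d
    using that pg_darts_props(3)[of "fst d" "snd d"] pg_darts_props(3)[of "snd d" "fst d"]
    by (auto simp: prod.swap_def)
  have neg: "g (pg_dart (prod.swap d)) = - g (pg_dart d)" if "d \<in> ?D" for d
  proof -
    have "dart_edge (pg_dart d) \<in> petersen_edges"
      using pg_cycles_trace(1)[OF k p] imageI[OF imageI[OF that], of dart_edge pg_dart]
      unfolding traces_cycle_darts set_darts_map by blast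
    thus ?thesis using g[of "pg_dart d"] by (cases d) simp
  qed
  define c where "c = (\<lambda>d. if d \<in> ?D then 1 else if prod.swap d \<in> ?D then -1 else (0::real))"
  have "(\<Sum>d\<in>set (darts (map pg_vertex p)). g d) = (\<Sum>d\<in>?D. g (pg_dart d))"
    by (simp add: set_darts_map sum.reindex[OF inj])
  \<comment> \<open>The darts are split into those that follow \<open>pg_darts\<close> and those
    that oppose it; the latter are indexed by their reverses, and \<open>neg\<close> supplies the
    sign.\<close>
  also have "\<dots> = (\<Sum>d\<in>?D \<inter> ?O. g (pg_dart d)) + (\<Sum>d\<in>?D - ?O. g (pg_dart d))"
    by (rule sum.Int_Diff) simp
  also have "(\<Sum>d\<in>?D - ?O. g (pg_dart d)) = (\<Sum>d\<in>{d\<in>?O. prod.swap d \<in> ?D}. - g (pg_dart d))"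
  proof (rule sum.reindex_bij_witness[of _ prod.swap prod.swap])
    fix d assume d: "d \<in> ?D - ?O"
    thus "prod.swap d \<in> {d\<in>?O. prod.swap d \<in> ?D}" using cover[of d] by auto
    show "- g (pg_dart (prod.swap d)) = g (pg_dart d)" using neg d by simp
  qed (use Oasym in auto)
  also have "(\<Sum>d\<in>?D \<inter> ?O. g (pg_dart d)) + (\<Sum>d\<in>{d\<in>?O. prod.swap d \<in> ?D}. - g (pg_dart d))
     = (\<Sum>d\<in>?O. c d * g (pg_dart d))"
  proof -
    have "(\<Sum>d\<in>?O. c d * g (pg_dart d)) =
        (\<Sum>d\<in>?O. (if d \<in> ?D then g (pg_dart d) else 0) + (if prod.swap d \<in> ?D then - g (pg_dart d) else 0))"
      by (intro sum.cong refl) (auto simp: c_def dest: asym)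
    also have "\<dots> = (\<Sum>d\<in>?O \<inter> ?D. g (pg_dart d)) + (\<Sum>d\<in>{d\<in>?O. prod.swap d \<in> ?D}. - g (pg_dart d))"
      unfolding sum.distrib
      by (intro arg_cong2[of _ _ _ _ "(+)"] sum.inter_restrict[symmetric] sum.inter_filter[symmetric]) simp_all
    finally show ?thesis by (simp only: Int_commute)
  qed
  also have "(\<Sum>d\<in>?O. c d * g (pg_dart d)) = (\<Sum>d\<leftarrow>pg_darts. c d * g (pg_dart d))"
    by (rule sum_list_distinct_conv_sum_set[symmetric, OF pg_darts_props(1)])
  also have "\<dots> = (\<Sum>i<15. of_int (pg_chain p ! i) * g (pg_dart (pg_darts ! i)))"
    unfolding sum_list_sum_nth length_map pg_darts_props(2) atLeast0LessThan
    by (intro sum.cong refl) (simp add: pg_darts_props(2) pg_chain_nth c_def)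
  finally show ?thesis .
qed

lemma pg_dart_sum:
  fixes G :: "petersen_vertex \<times> petersen_vertex \<Rightarrow> petersen_vertex \<times> petersen_vertex \<Rightarrow> real"
  assumes k: "3 \<le> k" and p: "p \<in> set (pg_cycles k)"
    and G: "\<And>c d. dart_edge c \<in> petersen_edges \<Longrightarrow> dart_edge d \<in> petersen_edges \<Longrightarrow> G (prod.swap c) d = - G c d"
      "\<And>c d. dart_edge c \<in> petersen_edges \<Longrightarrow> dart_edge d \<in> petersen_edges \<Longrightarrow> G c (prod.swap d) = - G c d"
  shows "dart_sum G (map pg_vertex p) = (\<Sum>i<15. \<Sum>j<15. of_int (pg_chain p ! i) * of_int (pg_chain p ! j) *
     G (pg_dart (pg_darts ! i)) (pg_dart (pg_darts ! j)))"
proof -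
  let ?D = "set (darts (map pg_vertex p))"
  have E: "dart_edge d \<in> petersen_edges" if "d \<in> ?D" for d
    using pg_cycles_trace(1)[OF k p] that unfolding traces_cycle_darts by blast
  have edge: "dart_edge (pg_dart (pg_darts ! j)) \<in> petersen_edges" if "j < 15" for j
  proof -
    obtain x y where xy: "pg_darts ! j = (x, y)" by (cases "pg_darts ! j")
    hence O: "(x, y) \<in> set pg_darts" using that pg_darts_props(2) by (metis nth_mem)
    hence "x < 10" "y < 10" using pg_darts_props(3)[of x y] by auto
    thus ?thesis using O xy by (simp add: pg_edge_iff_nbrs pg_nbrs_iff_darts)
  qed
  have "dart_sum G (map pg_vertex p) =
      (\<Sum>c\<in>?D. \<Sum>j<15. of_int (pg_chain p ! j) * G c (pg_dart (pg_darts ! j)))"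
    unfolding dart_sum_def by (intro sum.cong refl pg_chain_sum[OF k p] G(2)) (auto dest: E)
  also have "\<dots> = (\<Sum>j<15. of_int (pg_chain p ! j) * (\<Sum>c\<in>?D. G c (pg_dart (pg_darts ! j))))"
    by (subst sum.swap) (simp add: sum_distrib_left)
  also have "\<dots> = (\<Sum>j<15. of_int (pg_chain p ! j) *
      (\<Sum>i<15. of_int (pg_chain p ! i) * G (pg_dart (pg_darts ! i)) (pg_dart (pg_darts ! j))))"
    by (intro sum.cong refl arg_cong2[of _ _ _ _ "(*)"] pg_chain_sum[OF k p] G(1)) (auto intro: edge)
  also have "\<dots> = (\<Sum>i<15. \<Sum>j<15. of_int (pg_chain p ! i) * of_int (pg_chain p ! j) *
     G (pg_dart (pg_darts ! i)) (pg_dart (pg_darts ! j)))"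
    by (subst sum.swap) (simp add: sum_distrib_left mult_ac)
  finally show ?thesis .
qed

text \<open>The tracing behind \<open>F \<gamma>\<close> is arbitrary and may run against the
  enumerated one, but a quadratic value does not see the orientation. The sum over the cycles then
  acts only on the coefficients and gathers them into the matrix \<open>gram\<close>.\<close>

lemma sum_k_cycles:
  fixes F :: "petersen_vertex set set \<Rightarrow> real"
  assumes k: "3 \<le> k" and dist: "distinct (map (\<lambda>p. map abs (pg_chain p)) (pg_cycles k))"
    and F: "\<And>\<gamma>. \<gamma> \<in> cycles petersen_edges \<Longrightarrow>
      \<exists>vs. traces_cycle petersen_edges vs \<gamma> \<and> F \<gamma> = dart_sum G vs"
    and G: "\<And>c d. dart_edge c \<in> petersen_edges \<Longrightarrow> dart_edge d \<in> petersen_edges \<Longrightarrow> G (prod.swap c) d = - G c d"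
      "\<And>c d. dart_edge c \<in> petersen_edges \<Longrightarrow> dart_edge d \<in> petersen_edges \<Longrightarrow> G c (prod.swap d) = - G c d"
  shows "(\<Sum>\<gamma>\<in>k_cycles k petersen_edges. F \<gamma>) = (\<Sum>i<15. \<Sum>j<15.
    of_int (gram 15 (map pg_chain (pg_cycles k)) ! i ! j) * G (pg_dart (pg_darts ! i)) (pg_dart (pg_darts ! j)))"
proof -
  have "(\<Sum>\<gamma>\<in>k_cycles k petersen_edges. F \<gamma>) = (\<Sum>p\<in>set (pg_cycles k). F (pg_edges p))"
    by (rule sum.reindex_bij_betw[OF pg_cycles_bij[OF k dist], symmetric])
  also have "\<dots> = (\<Sum>p\<leftarrow>pg_cycles k. F (pg_edges p))"
    using dist by (intro sum_list_distinct_conv_sum_set[symmetric]) (simp only: distinct_map)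
  also have "\<dots> = (\<Sum>p\<leftarrow>pg_cycles k. \<Sum>i<15. \<Sum>j<15. of_int (pg_chain p ! i) * of_int (pg_chain p ! j) *
     G (pg_dart (pg_darts ! i)) (pg_dart (pg_darts ! j)))"
  proof (intro arg_cong[of _ _ sum_list] map_cong refl)
    fix p assume p: "p \<in> set (pg_cycles k)"
    have "pg_edges p \<in> cycles petersen_edges"
      using pg_cycles_trace(1)[OF k p] by (auto simp: cycles_def)
    then obtain vs where vs: "traces_cycle petersen_edges vs (pg_edges p)" "F (pg_edges p) = dart_sum G vs"
      using F by blast
    have "length vs = k"
      using card_traces_cycle[OF vs(1)] card_traces_cycle[OF pg_cycles_trace(1)[OF k p]]
        pg_cycles_trace(2)[OF k p] by simp
    then obtain q where q: "q \<in> set (pg_cycles k)" "pg_edges p = pg_edges q"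
      "set (darts (map pg_vertex q)) = set (darts vs) \<or>
       set (darts (map pg_vertex q)) = prod.swap ` set (darts vs)"
      using canonical_tracing[OF vs(1)] by blast
    have "p = q" using pg_cycles_bij[OF k dist] p q(1,2) by (auto simp: bij_betw_def dest: inj_onD)
    have E: "dart_edge d \<in> petersen_edges" if "d \<in> set (darts vs)" for d
      using vs(1) that unfolding traces_cycle_darts by blast
    have "dart_sum G (map pg_vertex q) = dart_sum G vs"
      using q(3)
    proof
      assume swap: "set (darts (map pg_vertex q)) = prod.swap ` set (darts vs)"
      have "G (prod.swap c) (prod.swap d) = G c d" if "c \<in> set (darts vs)" "d \<in> set (darts vs)" for c d
        using G(1)[of c "prod.swap d"] G(2)[of c d] E that by simp
      thus ?thesis unfolding dart_sum_def swap by (simp add: sum.reindex)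
    qed (simp add: dart_sum_def)
    hence "F (pg_edges p) = dart_sum G (map pg_vertex p)" using vs(2) \<open>p = q\<close> by simp
    also have "\<dots> = (\<Sum>i<15. \<Sum>j<15. of_int (pg_chain p ! i) * of_int (pg_chain p ! j) *
        G (pg_dart (pg_darts ! i)) (pg_dart (pg_darts ! j)))"
      by (rule pg_dart_sum[OF k p]) (use G in auto)
    finally show "F (pg_edges p) = (\<Sum>i<15. \<Sum>j<15. of_int (pg_chain p ! i) * of_int (pg_chain p ! j) *
        G (pg_dart (pg_darts ! i)) (pg_dart (pg_darts ! j)))" .
  qed
  also have "\<dots> = (\<Sum>c\<leftarrow>map pg_chain (pg_cycles k). \<Sum>i<15. \<Sum>j<15. of_int (c ! i) * of_int (c ! j) *
     G (pg_dart (pg_darts ! i)) (pg_dart (pg_darts ! j)))"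
    by (simp add: comp_def)
  also have "\<dots> = (\<Sum>i<15. \<Sum>j<15.
    of_int (gram 15 (map pg_chain (pg_cycles k)) ! i ! j) * G (pg_dart (pg_darts ! i)) (pg_dart (pg_darts ! j)))"
    by (rule gram_sum) simp
  finally show ?thesis .
qed

lemma finite_petersen_edges: "finite petersen_edges"
proof -
  have "finite (UNIV :: petersen_vertex set)" using pg_vertex_bij bij_betw_finite by blast
  hence "finite (UNIV :: petersen_vertex set set)" by (simp add: Finite_Set.finite_set)
  thus ?thesis by (rule finite_subset[OF subset_UNIV])
qed

lemma finite_petersen_cycles: "finite (cycles petersen_edges)"
proof -
  have "cycles petersen_edges \<subseteq> Pow petersen_edges" by (auto simp: cycles_def traces_cycle_def)
  thus ?thesis using finite_petersen_edges by (meson finite_Pow_iff finite_subset)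
qed

lemma length_petersen_cycle:
  assumes "traces_cycle petersen_edges vs \<gamma>"
  shows "length vs \<in> {5, 6, 8, 9}"
proof -
  have ge: "3 \<le> length vs" and "distinct vs" using assms by (auto simp: traces_cycle_def)
  hence "length vs = card (set vs)" by (simp add: distinct_card)
  also have "\<dots> \<le> card (UNIV :: petersen_vertex set)"
    using pg_vertex_bij bij_betw_finite by (intro card_mono) blast+
  also have "\<dots> = 10" using bij_betw_same_card[OF pg_vertex_bij] by simp
  finally have "length vs \<le> 10" .
  moreover have "pg_cycles (length vs) \<noteq> []" using canonical_tracing[OF assms] by auto
  ultimately have "length vs \<notin> {3, 4, 7, 10}" using pg_cycles_empty by auto
  thus ?thesis using ge \<open>length vs \<le> 10\<close> by auto
qed

text \<open>The combinatorial half: the relations hold for any quantity that is the value at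
  \<gamma> \<otimes> \<gamma> of one fixed form which changes sign when a dart is reversed. The
  total factor is 1 + 1 + 2 + 3 = 7.\<close>

theorem petersen_cycle_sums:
  fixes F :: "petersen_vertex set set \<Rightarrow> real"
  assumes F: "\<And>\<gamma>. \<gamma> \<in> cycles petersen_edges \<Longrightarrow>
      \<exists>vs. traces_cycle petersen_edges vs \<gamma> \<and> F \<gamma> = dart_sum G vs"
    and G: "\<And>c d. dart_edge c \<in> petersen_edges \<Longrightarrow> dart_edge d \<in> petersen_edges \<Longrightarrow> G (prod.swap c) d = - G c d"
      "\<And>c d. dart_edge c \<in> petersen_edges \<Longrightarrow> dart_edge d \<in> petersen_edges \<Longrightarrow> G c (prod.swap d) = - G c d"
  defines "T \<equiv> \<lambda>k. \<Sum>\<gamma>\<in>k_cycles k petersen_edges. F \<gamma>"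
  shows "T 6 = T 5" "T 8 = 2 * T 5" "T 9 = 3 * T 5" "(\<Sum>\<gamma>\<in>cycles petersen_edges. F \<gamma>) = 7 * T 5"
proof -
  let ?M = "gram 15 (map pg_chain (pg_cycles 5))"
  have M: "map (map (\<lambda>m. a * m)) ?M ! i ! j = a * ?M ! i ! j" if "i < 15" "j < 15" for a i j
    using gram_length[of "map pg_chain (pg_cycles 5)" 15] that by (simp add: nth_map)
  define g where "g = (\<lambda>i j. G (pg_dart (pg_darts ! i)) (pg_dart (pg_darts ! j)))"
  have T: "T k = (\<Sum>i<15. \<Sum>j<15. of_int (gram 15 (map pg_chain (pg_cycles k)) ! i ! j) * g i j)"
    if "3 \<le> k" "distinct (map (\<lambda>p. map abs (pg_chain p)) (pg_cycles k))" for k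
    unfolding T_def g_def using that by (rule sum_k_cycles[where F = F and G = G, OF _ _ F G])
  have T5: "T 5 = (\<Sum>i<15. \<Sum>j<15. of_int (?M ! i ! j) * g i j)"
    by (rule T[OF _ pg_chains_distinct(1)]) simp
  show 6: "T 6 = T 5"
    unfolding T5 pg_gram(1)[symmetric] by (rule T[OF _ pg_chains_distinct(2)]) simp
  have multiple: "(\<Sum>i<15. \<Sum>j<15. of_int (map (map (\<lambda>m. a * m)) ?M ! i ! j) * g i j) = of_int a * T 5" for a
  proof -
    have "(\<Sum>i<15. \<Sum>j<15. of_int (map (map (\<lambda>m. a * m)) ?M ! i ! j) * g i j) =
        (\<Sum>i<15. \<Sum>j<15. of_int a * (of_int (?M ! i ! j) * g i j))"
    proof (intro sum.cong refl)
      fix i j :: nat assume "i \<in> {..<15}" "j \<in> {..<15}"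
      hence "map (map (\<lambda>m. a * m)) ?M ! i ! j = a * ?M ! i ! j" by (intro M) simp_all
      thus "of_int (map (map (\<lambda>m. a * m)) ?M ! i ! j) * g i j = of_int a * (of_int (?M ! i ! j) * g i j)"
        by (simp only: of_int_mult mult.assoc)
    qed
    thus ?thesis unfolding T5 by (simp only: sum_distrib_left)
  qed
  have "T 8 = of_int 2 * T 5"
    unfolding multiple[symmetric] pg_gram(2)[symmetric] by (rule T[OF _ pg_chains_distinct(3)]) simp
  thus 8: "T 8 = 2 * T 5" by simp
  have "T 9 = of_int 3 * T 5"
    unfolding multiple[symmetric] pg_gram(3)[symmetric] by (rule T[OF _ pg_chains_distinct(4)]) simp
  thus 9: "T 9 = 3 * T 5" by simp
  have "card ` cycles petersen_edges \<subseteq> {5, 6, 8, 9}"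
    using length_petersen_cycle card_traces_cycle by (fastforce simp: cycles_def)
  with finite_petersen_cycles have "(\<Sum>\<gamma>\<in>cycles petersen_edges. F \<gamma>) = (\<Sum>k\<in>{5, 6, 8, 9}. T k)"
    unfolding T_def k_cycles_def by (intro sum.group[symmetric]) auto
  thus "(\<Sum>\<gamma>\<in>cycles petersen_edges. F \<gamma>) = 7 * T 5" using 6 8 9 by simp
qed

section \<open>The Thurston--Bennequin number of a smoothed cycle\<close>

lemma integral_reflect_unit:
  fixes f :: "real \<Rightarrow> real"
  shows "integral {0..1} (\<lambda>t. f (1 - t)) = integral {0..1} f"
  using integral_shift_Icc_real[of "-1" 0 "\<lambda>t. f t" 1] Henstock_Kurzweil_Integration.integral_reflect_real[of 0 "-1" "\<lambda>t. f (1 + t)"]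
  by (simp add: comp_def)

text \<open>The substitution \<open>1 - t\<close> preserves the unit interval, and only the velocity
  changes sign. Reflection and negation pass through \<open>integral\<close> even where it is
  undefined, so pairs of arcs that meet are covered as well.\<close>

lemma gauss_integral_reverse:
  "gauss_integral (\<lambda>t. A (1 - t)) (\<lambda>t. - A' (1 - t)) B B' = - gauss_integral A A' B B'"
  "gauss_integral A A' (\<lambda>t. B (1 - t)) (\<lambda>t. - B' (1 - t)) = - gauss_integral A A' B B'"
proof -
  have "gauss_integral (\<lambda>t. A (1 - t)) (\<lambda>t. - A' (1 - t)) B B' =
      - integral {0..1} (\<lambda>t. integral {0..1} (\<lambda>u. gauss_form (A (1 - t) - B u) (A' (1 - t)) (B' u)))"
    by (simp add: gauss_integral_def gauss_form_neg)
  moreover have "integral {0..1} (\<lambda>t. integral {0..1} (\<lambda>u. gauss_form (A (1 - t) - B u) (A' (1 - t)) (B' u)))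
      = gauss_integral A A' B B'"
    unfolding gauss_integral_def
    by (rule integral_reflect_unit[of "\<lambda>t. integral {0..1} (\<lambda>u. gauss_form (A t - B u) (A' t) (B' u))"])
  ultimately show "gauss_integral (\<lambda>t. A (1 - t)) (\<lambda>t. - A' (1 - t)) B B' = - gauss_integral A A' B B'"
    by simp
  have "integral {0..1} (\<lambda>u. gauss_form (A t - B (1 - u)) (A' t) (- B' (1 - u))) =
      - integral {0..1} (\<lambda>u. gauss_form (A t - B u) (A' t) (B' u))" for t
    using integral_reflect_unit[of "\<lambda>u. gauss_form (A t - B u) (A' t) (B' u)"]
    by (simp add: gauss_form_neg)
  thus "gauss_integral A A' (\<lambda>t. B (1 - t)) (\<lambda>t. - B' (1 - t)) = - gauss_integral A A' B B'"
    by (simp add: gauss_integral_def)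
qed

lemma gauss_integral_cong:
  assumes "\<And>t. t \<in> {0..1} \<Longrightarrow> A t = C t" "\<And>t. t \<in> {0..1} \<Longrightarrow> A' t = C' t"
    "\<And>t. t \<in> {0..1} \<Longrightarrow> B t = D t" "\<And>t. t \<in> {0..1} \<Longrightarrow> B' t = D' t"
  shows "gauss_integral A A' B B' = gauss_integral C C' D D'"
  unfolding gauss_integral_def by (intro integral_cong) (simp add: assms)

lemma integral_unit_intervals:
  fixes f :: "real \<Rightarrow> real"
  assumes "continuous_on {0..real k} f"
  shows "integral {0..real k} f = (\<Sum>i<k. integral {0..1} (\<lambda>t. f (real i + t)))"
  using assms
proof (induction k)
  case (Suc k)
  have "integral {0..real (Suc k)} f = integral {0..real k} f + integral {real k..real (Suc k)} f"
    by (rule Henstock_Kurzweil_Integration.integral_combine[symmetric])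
       (use Suc.prems in \<open>auto intro: integrable_continuous_real\<close>)
  also have "integral {real k..real (Suc k)} f = integral {0..1} (\<lambda>t. f (real k + t))"
    using integral_shift_Icc_real[of 0 1 f "real k"] by (simp add: comp_def add.commute)
  also have "integral {0..real k} f = (\<Sum>i<k. integral {0..1} (\<lambda>t. f (real i + t)))"
    by (intro Suc.IH continuous_on_subset[OF Suc.prems]) auto
  finally show ?case by simp
qed simp

text \<open>Cutting both periods at the integers brings the linking integral of a smooth knot and
  its push-off into the same double sum that the edges of the graph produce, so that a homotopy of
  chains of arcs can join the two.\<close>

lemma linking_number_pieces:
  assumes A: "\<And>t. (A has_vector_derivative A' t) (at t)" "continuous_on UNIV A'"
    and B: "\<And>t. (B has_vector_derivative B' t) (at t)" "continuous_on UNIV B'"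
    and disj: "\<And>t u. A t \<noteq> B u"
  shows "linking_number k A B = 1 / (4 * pi) * (\<Sum>i<k. \<Sum>j<k.
    gauss_integral (\<lambda>t. A (real i + t)) (\<lambda>t. A' (real i + t)) (\<lambda>u. B (real j + u)) (\<lambda>u. B' (real j + u)))"
proof -
  define g where "g = (\<lambda>t u. gauss_form (A t - B u) (A' t) (B' u))"
  have AB: "continuous_on UNIV A" "continuous_on UNIV B"
    using A(1) B(1) by (auto intro!: continuous_at_imp_continuous_on has_vector_derivative_continuous)
  have g: "continuous_on S (\<lambda>p. g (x p) (y p))"
    if "continuous_on S x" "continuous_on S y" for S :: "'c::topological_space set" and x y
    unfolding g_def
    by (intro continuous_intros continuous_on_compose2[OF AB(1)] continuous_on_compose2[OF AB(2)]
        continuous_on_compose2[OF A(2)] continuous_on_compose2[OF B(2)] that) (use disj in auto)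
  have param: "continuous_on U (\<lambda>t. integral {0..1} (\<lambda>u. g (a + t) (b + u)))" for U a b
  proof -
    have "continuous_on (Sigma U (\<lambda>_. cbox 0 1)) (\<lambda>(t, u). g (a + t) (b + u))"
      unfolding case_prod_unfold by (intro g continuous_intros)
    from integral_continuous_on_param[OF this] show ?thesis by simp
  qed
  have inner: "integral {0..real k} (\<lambda>u. g t u) = (\<Sum>j<k. integral {0..1} (\<lambda>u. g t (real j + u)))" for t
    by (rule integral_unit_intervals) (intro g continuous_intros)
  have "integral {0..real k} (\<lambda>t. \<Sum>j<k. integral {0..1} (\<lambda>u. g t (real j + u))) =
      (\<Sum>i<k. integral {0..1} (\<lambda>t. \<Sum>j<k. integral {0..1} (\<lambda>u. g (real i + t) (real j + u))))"
    by (rule integral_unit_intervals) (use param[of _ 0] in \<open>auto intro!: continuous_intros\<close>)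
  also have "\<dots> = (\<Sum>i<k. \<Sum>j<k. integral {0..1} (\<lambda>t. integral {0..1} (\<lambda>u. g (real i + t) (real j + u))))"
    by (intro sum.cong refl integral_sum integrable_continuous_real param) simp
  finally have "integral {0..real k} (\<lambda>t. integral {0..real k} (\<lambda>u. g t u)) = \<dots>"
    unfolding inner .
  moreover have "vector_derivative A (at t) = A' t" "vector_derivative B (at t) = B' t" for t
    using A(1) B(1) by (simp_all add: vector_derivative_at)
  ultimately show ?thesis
    by (simp add: linking_number_def gauss_integral_def g_def gauss_form_def)
qed

section \<open>Closed curves assembled from arcs\<close>

definition loop :: "nat \<Rightarrow> (nat \<Rightarrow> real \<Rightarrow> 'a) \<Rightarrow> real \<Rightarrow> 'a" where
  "loop k c t = c (nat (\<lfloor>t\<rfloor> mod int k)) (frac t)"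

lemma cycle_curve_eq_loop:
  "cycle_curve e vs = loop (length vs) (\<lambda>i. e (vs ! i) (vs ! (Suc i mod length vs)))"
  by (rule ext) (simp add: cycle_curve_def loop_def Let_def)

lemma loop_periodic: "loop k c (t + real k) = loop k c t"
proof -
  have "\<lfloor>t + real k\<rfloor> = \<lfloor>t\<rfloor> + int k" "frac (t + real k) = frac t"
    by (simp_all add: frac_def floor_add_int[of t "int k", simplified])
  thus ?thesis by (simp add: loop_def)
qed

lemma loop_interior:
  assumes "of_int n < t" "t < of_int n + 1"
  shows "loop k c t = c (nat (n mod int k)) (t - of_int n)"
proof -
  have "\<lfloor>t\<rfloor> = n" using assms by linarith
  thus ?thesis by (simp add: loop_def frac_def)
qed

text \<open>At \<open>t = 1\<close> the loop already uses the next arc, whose start is the end of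
  the current one; closedness thus extends the formula to the closed unit interval.\<close>

lemma loop_closed_piece:
  assumes k: "0 < k" and closed: "\<And>i. i < k \<Longrightarrow> c i 1 = c (Suc i mod k) 0"
    and t: "t \<in> {0..1}"
  shows "loop k c (of_int n + t) = c (nat (n mod int k)) t"
proof (cases "t = 1")
  case True
  define i where "i = nat (n mod int k)"
  have i: "i < k" "int i = n mod int k" using k by (simp_all add: i_def nat_less_iff)
  have "(n + 1) mod int k = int (Suc i mod k)"
    by (simp add: zmod_int i(2) mod_simps add.commute)
  hence "loop k c (of_int n + t) = c (Suc i mod k) 0"
    using True by (simp add: loop_def frac_def)
  thus ?thesis using closed[OF i(1)] True by (simp add: i_def)
next
  case False
  hence "\<lfloor>of_int n + t\<rfloor> = n" using t by (simp add: floor_eq_iff)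
  thus ?thesis by (simp add: loop_def frac_def)
qed

lemma not_Ints_floor: "t \<notin> \<int> \<Longrightarrow> of_int \<lfloor>t\<rfloor> < (t::real) \<and> t < of_int \<lfloor>t\<rfloor> + 1"
proof -
  assume "t \<notin> \<int>"
  hence "of_int \<lfloor>t\<rfloor> \<noteq> t" by (metis Ints_of_int)
  thus ?thesis by linarith
qed

lemma loop_has_vector_derivative:
  fixes c c' :: "nat \<Rightarrow> real \<Rightarrow> 'a::real_normed_vector"
  assumes k: "0 < k"
    and c: "\<And>i x. i < k \<Longrightarrow> x \<in> {0..1} \<Longrightarrow> (c i has_vector_derivative c' i x) (at x within {0..1})"
    and t: "t \<notin> \<int>"
  shows "(loop k c has_vector_derivative loop k c' t) (at t)"
proof -
  define n where "n = \<lfloor>t\<rfloor>"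
  define i where "i = nat (n mod int k)"
  have i: "i < k" using k by (simp add: i_def nat_less_iff)
  have n: "of_int n < t" "t < of_int n + 1" using not_Ints_floor[OF t] by (simp_all add: n_def)
  have "(c i has_vector_derivative c' i (t - of_int n)) (at (t - of_int n) within {0..1})"
    using n by (intro c i) auto
  hence "(c i has_vector_derivative c' i (t - of_int n)) (at (t - of_int n))"
    using n by (simp add: at_within_Icc_at)
  moreover have "((\<lambda>t. t - of_int n) has_vector_derivative 1) (at t)"
    by (auto intro!: derivative_eq_intros)
  ultimately have "(c i \<circ> (\<lambda>t. t - of_int n) has_vector_derivative 1 *\<^sub>R c' i (t - of_int n)) (at t)"
    by (intro vector_diff_chain_at)
  hence "(c i \<circ> (\<lambda>t. t - of_int n) has_vector_derivative loop k c' t) (at t)"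
    using n by (simp add: loop_interior i_def)
  thus ?thesis
    by (rule has_vector_derivative_transform_within_open[of _ _ _ "{of_int n<..<of_int n + 1}"])
       (use n in \<open>auto simp: loop_interior i_def\<close>)
qed

lemma loop_continuous:
  fixes c :: "nat \<Rightarrow> real \<Rightarrow> 'a::real_normed_vector"
  assumes k: "0 < k" and closed: "\<And>i. i < k \<Longrightarrow> c i 1 = c (Suc i mod k) 0"
    and c: "\<And>i. i < k \<Longrightarrow> continuous_on {0..1} (c i)"
  shows "continuous_on UNIV (loop k c)"
proof -
  have piece: "continuous_on {of_int n..of_int n + 1} (loop k c)" for n
  proof -
    have "continuous_on {of_int n..of_int n + 1} (\<lambda>t. c (nat (n mod int k)) (t - of_int n))"
      by (rule continuous_on_compose2[OF c]) (use k in \<open>auto intro!: continuous_intros simp: nat_less_iff\<close>)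
    moreover have "c (nat (n mod int k)) (t - of_int n) = loop k c t" if "t \<in> {of_int n..of_int n + 1}" for t
      using loop_closed_piece[where c = c and n = n and t = "t - of_int n", OF k closed] that by simp
    ultimately show ?thesis by (rule continuous_on_eq)
  qed
  have "isCont (loop k c) t" for t
  proof -
    define n where "n = \<lfloor>t\<rfloor>"
    have n: "of_int (n - 1) + 1 \<le> t" "t < of_int n + 1" by (simp_all add: n_def)
    \<comment> \<open>Two adjacent closed pieces are needed because \<open>t\<close> may be an
      integer; their union has \<open>t\<close> in its interior.\<close>
    have "continuous_on ({of_int (n - 1)..of_int (n - 1) + 1} \<union> {of_int n..of_int n + 1}) (loop k c)"
      by (intro continuous_on_closed_Un piece) auto
    also have "{of_int (n - 1)..of_int (n - 1) + 1} \<union> {of_int n..of_int n + 1} = {of_int (n - 1)..real_of_int n + 1}"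
      by auto
    finally show ?thesis
      using n by (intro continuous_on_interior[of "{of_int (n - 1)..real_of_int n + 1}"]) auto
  qed
  thus ?thesis by (simp add: continuous_at_imp_continuous_on)
qed

section \<open>From an embedding and a smoothing to a rounded curve\<close>

lemma smooth_C1_arc:
  assumes "smooth_curve_on {0..1} g"
  shows "C1_arc g (\<lambda>t. vector_derivative g (at t within {0..1}))"
proof -
  obtain D where D: "\<forall>t\<in>{0..1}. D 0 t = g t"
    "\<And>n t. t \<in> {0..1} \<Longrightarrow> (D n has_vector_derivative D (Suc n) t) (at t within {0..1})"
    using assms unfolding smooth_curve_on_def by blast
  have g: "(g has_vector_derivative D 1 t) (at t within {0..1})" if "t \<in> {0..1}" for t
    by (rule has_vector_derivative_transform_within[of "D 0" _ _ _ 1]) (use D that in auto)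
  have eq: "vector_derivative g (at t within {0..1}) = D 1 t" if "t \<in> {0..1}" for t
    using that g[OF that] by (intro vector_derivative_within_closed_interval) auto
  have "continuous_on {0..1} (D 1)"
    by (rule continuous_on_vector_derivative) (use D(2)[of _ 1] in auto)
  hence "continuous_on {0..1} (\<lambda>t. vector_derivative g (at t within {0..1}))"
    by (rule continuous_on_eq) (use eq in auto)
  thus ?thesis unfolding C1_arc_def using g eq by auto
qed

lemma periodic_vector_derivative:
  assumes f: "\<And>t. (f has_vector_derivative f' t) (at t)" and per: "\<And>t. f (t + c) = f t"
  shows "f' (t + c) = f' t"
proof -
  have "((\<lambda>t. t + c) has_vector_derivative 1) (at t)" by (auto intro!: derivative_eq_intros)
  hence "(f \<circ> (\<lambda>t. t + c) has_vector_derivative 1 *\<^sub>R f' (t + c)) (at t)"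
    using f by (rule vector_diff_chain_at)
  hence "(f has_vector_derivative f' (t + c)) (at t)" by (simp add: comp_def per)
  thus ?thesis using f by (rule vector_derivative_unique_at)
qed

lemma traces_cycle_edge_inj:
  assumes "traces_cycle E vs \<gamma>" "i < length vs" "j < length vs"
    "{vs ! i, vs ! (Suc i mod length vs)} = {vs ! j, vs ! (Suc j mod length vs)}"
  shows "i = j"
proof -
  have vs: "distinct vs" "3 \<le> length vs" using assms(1) by (auto simp: traces_cycle_def)
  have in_d: "(vs ! i, vs ! (Suc i mod length vs)) \<in> set (darts vs)"
    "(vs ! j, vs ! (Suc j mod length vs)) \<in> set (darts vs)"
    using assms(2,3) unfolding darts_conv_nth by blast+
  have "vs ! i = vs ! j"
    using assms(4) darts_asym[OF vs in_d(1)] in_d(2) by (auto simp: doubleton_eq_iff)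
  thus ?thesis using vs assms(2,3) by (simp add: nth_eq_iff_index_eq)
qed

lemma legendrian_embeddingD:
  assumes "legendrian_embedding V E p e"
  shows "inj_on p V"
    "{a, b} \<in> E \<Longrightarrow> e a b 0 = p a" "{a, b} \<in> E \<Longrightarrow> e a b 1 = p b"
    "{a, b} \<in> E \<Longrightarrow> t \<in> {0..1} \<Longrightarrow> e b a t = e a b (1 - t)"
    "{a, b} \<in> E \<Longrightarrow> legendrian_curve_on {0..1} (e a b)"
    "{a, b} \<in> E \<Longrightarrow> inj_on (e a b) {0<..<1}"
    "{a, b} \<in> E \<Longrightarrow> p ` V \<inter> e a b ` {0<..<1} = {}"
    "{a, b} \<in> E \<Longrightarrow> {c, d} \<in> E \<Longrightarrow> {a, b} \<noteq> {c, d} \<Longrightarrow> e a b ` {0<..<1} \<inter> e c d ` {0<..<1} = {}"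
proof -
  note emb = assms[unfolded legendrian_embedding_def]
  note arc = emb[THEN conjunct1, rule_format] and emb' = emb[THEN conjunct2, THEN conjunct2]
  show "inj_on p V" by (rule emb[THEN conjunct2, THEN conjunct1])
  show "{a, b} \<in> E \<Longrightarrow> e a b 0 = p a" "{a, b} \<in> E \<Longrightarrow> e a b 1 = p b"
    "{a, b} \<in> E \<Longrightarrow> legendrian_curve_on {0..1} (e a b)"
    using arc[of a b] by simp_all
  show "{a, b} \<in> E \<Longrightarrow> t \<in> {0..1} \<Longrightarrow> e b a t = e a b (1 - t)"
    using arc[of a b] by simp
  show "{a, b} \<in> E \<Longrightarrow> inj_on (e a b) {0<..<1}" "{a, b} \<in> E \<Longrightarrow> p ` V \<inter> e a b ` {0<..<1} = {}"
    using emb'[THEN conjunct1, rule_format, of a b] by simp_all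
  show "{a, b} \<in> E \<Longrightarrow> {c, d} \<in> E \<Longrightarrow> {a, b} \<noteq> {c, d} \<Longrightarrow> e a b ` {0<..<1} \<inter> e c d ` {0<..<1} = {}"
    by (rule emb'[THEN conjunct2, THEN conjunct1, rule_format])
qed

text \<open>The corner data of a smoothing, given for \<open>i < k\<close>, are extended to all
  integers by translation along the period, and the graph embedding provides injectivity of the
  cycle curve.\<close>

lemma smoothing_rounded_curve:
  assumes emb: "legendrian_embedding UNIV E p e" and tr: "traces_cycle E vs \<gamma>"
    and sm: "legendrian_smoothing (length vs) (cycle_curve e vs) L"
  shows "\<exists>K' K'' L' L'' r a b w. rounded_curve (length vs) (cycle_curve e vs) K' K'' L L' L'' r a b w"
proof -
  define k where "k = length vs"
  define c where "c = (\<lambda>i. e (vs ! i) (vs ! (Suc i mod k)))"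
  define K where "K = cycle_curve e vs"
  have K_loop: "K = loop k c" by (simp add: K_def cycle_curve_eq_loop c_def k_def)
  have k3: "3 \<le> k" and dist: "distinct vs" using tr by (auto simp: traces_cycle_def k_def)
  hence k0: "0 < k" by simp
  have edge: "{vs ! i, vs ! (Suc i mod k)} \<in> E" if "i < k" for i
    using tr that unfolding traces_cycle_def k_def by blast
  note emb' = legendrian_embeddingD[OF emb]
  have c01: "c i 0 = p (vs ! i)" "c i 1 = p (vs ! (Suc i mod k))"
    and leg: "legendrian_curve_on {0..1} (c i)"
    and c_inj: "inj_on (c i) {0<..<1}" and c_p: "range p \<inter> c i ` {0<..<1} = {}" if "i < k" for i
    unfolding c_def by (rule emb'(2,3,5,6,7)[OF edge[OF that]])+
  have c_disj: "c i ` {0<..<1} \<inter> c j ` {0<..<1} = {}" if "i < k" "j < k" "i \<noteq> j" for i j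
  proof -
    have "{vs ! i, vs ! (Suc i mod k)} \<noteq> {vs ! j, vs ! (Suc j mod k)}"
      using traces_cycle_edge_inj[OF tr] that by (auto simp: k_def)
    thus ?thesis unfolding c_def by (intro emb'(8) edge that)
  qed
  have closed: "c i 1 = c (Suc i mod k) 0" if "i < k" for i
    using c01(2)[OF that] c01(1)[of "Suc i mod k"] k0 by simp
  have "\<exists>D. (\<forall>t\<in>{0..1}. D 0 t = c i t) \<and>
      (\<forall>n. \<forall>t\<in>{0..1}. (D n has_vector_derivative D (Suc n) t) (at t within {0..1}))" if "i < k" for i
    using leg[OF that] by (auto simp: legendrian_curve_on_def smooth_curve_on_def)
  then obtain D where D: "\<And>i t. i < k \<Longrightarrow> t \<in> {0..1} \<Longrightarrow> D i 0 t = c i t"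
    "\<And>i n t. i < k \<Longrightarrow> t \<in> {0..1} \<Longrightarrow> (D i n has_vector_derivative D i (Suc n) t) (at t within {0..1})"
    by metis
  have c': "(c i has_vector_derivative D i 1 t) (at t within {0..1})" if "i < k" "t \<in> {0..1}" for i t
    by (rule has_vector_derivative_transform_within[of "D i 0" _ _ _ 1]) (use D that in auto)
  have c'_leg: "D i 1 t \<noteq> 0 \<and> D i 1 t \<in> xi_std (c i t)" if "i < k" "t \<in> {0..1}" for i t
  proof -
    have "vector_derivative (c i) (at t within {0..1}) = D i 1 t"
      using that c' by (intro vector_derivative_within_closed_interval) auto
    thus ?thesis using leg[OF that(1)] that(2) unfolding legendrian_curve_on_def by metis
  qed
  define K' where "K' = loop k (\<lambda>i. D i 1)"
  define K'' where "K'' = loop k (\<lambda>i. D i 2)"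
  have K': "(K has_vector_derivative K' t) (at t)" if "t \<notin> \<int>" for t
    unfolding K_loop K'_def using that by (intro loop_has_vector_derivative k0 c')
  have K'': "(K' has_vector_derivative K'' t) (at t)" if "t \<notin> \<int>" for t
    unfolding K'_def K''_def using that D(2)[of _ _ 1]
    by (intro loop_has_vector_derivative k0) (auto simp: numeral_2_eq_2)
  have ix: "nat (n mod int k) < k" for n using k0 by (simp add: nat_less_iff)
  have K_leg: "K' t \<noteq> 0 \<and> K' t \<in> xi_std (K t)" for t
    unfolding K'_def K_loop loop_def using frac_ge_0[of t] frac_lt_1[of t]
    by (intro c'_leg ix) auto
  have K_period: "K (t + real k) = K t" for t unfolding K_loop by (rule loop_periodic)
  have K_cont: "continuous_on UNIV K"
    unfolding K_loop by (intro loop_continuous k0 closed continuous_on_vector_derivative[OF c'])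
  have K_inj: "inj_on K {0..<real k}"
  proof (rule inj_onI)
    fix t u assume t: "t \<in> {0..<real k}" and u: "u \<in> {0..<real k}" and eq: "K t = K u"
    \<comment> \<open>Every parameter in the period is a vertex or an interior point of an arc.
      Vertices never lie on open arcs, different open arcs are disjoint, and each of them is
      injective.\<close>
    have unit: "\<exists>i \<tau>. i < k \<and> t = real i + \<tau> \<and> (\<tau> = 0 \<or> \<tau> \<in> {0<..<1}) \<and> K t = c i \<tau>"
      if "t \<in> {0..<real k}" for t
    proof (intro exI conjI)
      show "nat \<lfloor>t\<rfloor> < k" "t = real (nat \<lfloor>t\<rfloor>) + frac t" using that by (simp_all add: frac_def) linarith+
      show "frac t = 0 \<or> frac t \<in> {0<..<1}" using frac_ge_0[of t] frac_lt_1[of t] by auto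
      have "\<lfloor>t\<rfloor> mod int k = \<lfloor>t\<rfloor>" using that by (simp add: floor_less_iff)
      thus "K t = c (nat \<lfloor>t\<rfloor>) (frac t)" by (simp add: K_loop loop_def)
    qed
    obtain i \<tau> where i: "i < k" "t = real i + \<tau>" "\<tau> = 0 \<or> \<tau> \<in> {0<..<1}" "K t = c i \<tau>" using unit[OF t] by blast
    obtain j \<upsilon> where j: "j < k" "u = real j + \<upsilon>" "\<upsilon> = 0 \<or> \<upsilon> \<in> {0<..<1}" "K u = c j \<upsilon>" using unit[OF u] by blast
    have vertex_arc: False if "i < k" "j < k" "\<upsilon> \<in> {0<..<1}" "c i 0 = c j \<upsilon>" for i j \<upsilon>
    proof -
      have "c j \<upsilon> \<in> range p" using c01(1)[OF that(1)] that(4) by simp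
      moreover have "c j \<upsilon> \<in> c j ` {0<..<1}" using that(3) by (rule imageI)
      ultimately show False using c_p[OF that(2)] by blast
    qed
    have eq': "c i \<tau> = c j \<upsilon>" using eq i(4) j(4) by simp
    have "i = j \<and> \<tau> = \<upsilon>"
      using i(3)
    proof
      assume \<tau>: "\<tau> = 0"
      have \<upsilon>: "\<upsilon> = 0" using vertex_arc[OF i(1) j(1), of \<upsilon>] eq' \<tau> j(3) by blast
      have "p (vs ! i) = p (vs ! j)" using eq' c01(1)[OF i(1)] c01(1)[OF j(1)] \<tau> \<upsilon> by simp
      hence "vs ! i = vs ! j" by (rule injD[OF emb'(1)])
      thus ?thesis using dist i(1) j(1) \<tau> \<upsilon> by (simp add: nth_eq_iff_index_eq k_def)
    next
      assume \<tau>: "\<tau> \<in> {0<..<1}"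
      have \<upsilon>: "\<upsilon> \<in> {0<..<1}" using vertex_arc[OF j(1) i(1) \<tau>] eq' j(3) by metis
      have "c i \<tau> \<in> c i ` {0<..<1}" "c i \<tau> \<in> c j ` {0<..<1}" using \<tau> \<upsilon> eq' by blast+
      hence "i = j" using c_disj[OF i(1) j(1)] by blast
      thus ?thesis using c_inj[OF i(1)] eq' \<tau> \<upsilon> by (auto dest: inj_onD)
    qed
    thus "t = u" using i(2) j(2) by simp
  qed
  note sm' = sm[folded k_def K_def, unfolded legendrian_smoothing_def]
  have L_leg: "legendrian_curve_on UNIV L" and L_period: "\<And>t. L (t + real k) = L t"
    using sm' by (auto simp: legendrian_knot_def)
  obtain F where F: "\<And>t. F 0 t = L t" "\<And>n t. (F n has_vector_derivative F (Suc n) t) (at t)"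
    using L_leg by (auto simp: legendrian_curve_on_def smooth_curve_on_def)
  define L' where "L' = F 1"
  define L'' where "L'' = F 2"
  have "F 0 = L" using F(1) by auto
  hence L': "(L has_vector_derivative L' t) (at t)" for t using F(2)[of 0 t] by (simp add: L'_def)
  have L'': "(L' has_vector_derivative L'' t) (at t)" for t
    using F(2)[of 1 t] by (simp add: L'_def L''_def numeral_2_eq_2)
  have vdL: "vector_derivative L (at t) = L' t" for t using L' by (rule vector_derivative_at)
  have L'_leg: "L' t \<noteq> 0 \<and> L' t \<in> xi_std (L t)" for t
    using L_leg by (simp add: legendrian_curve_on_def vdL)
  have L'_period: "L' (t + real k) = L' t" for t
    by (rule periodic_vector_derivative[OF L' L_period])
  have K'_period: "K' (t + real k) = K' t" for t unfolding K'_def by (rule loop_periodic)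
  define P where "P = (\<lambda>r i a b (w::real^3). real i - 1 < a \<and> a < real i \<and> real i < b \<and> b < real i + 1 \<and> w $ 3 = 0 \<and>
          (\<forall>t\<in>{real i - real k / 2..real i + real k / 2}.
             K t \<in> ball (K (real i)) r \<longleftrightarrow> t \<in> {a<..<b}) \<and>
          (\<forall>t\<in>{a<..<b}. L t \<in> ball (K (real i)) r \<and>
             0 < w \<bullet> vector_derivative L (at t) \<and>
             (t \<noteq> real i \<longrightarrow> 0 < w \<bullet> vector_derivative K (at t))))"
  have "\<exists>r>0. (\<forall>i<k. \<forall>j<k. i \<noteq> j \<longrightarrow> ball (K (real i)) r \<inter> ball (K (real j)) r = {}) \<and>
      (\<forall>t. (\<forall>i<k. K t \<notin> ball (K (real i)) r) \<longrightarrow> L t = K t) \<and> (\<forall>i<k. \<exists>a b w. P r i a b w)"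
    using sm'[THEN conjunct2] unfolding P_def .
  then obtain r where r: "0 < r"
    and balls: "\<forall>i<k. \<forall>j<k. i \<noteq> j \<longrightarrow> ball (K (real i)) r \<inter> ball (K (real j)) r = {}"
    and outside: "\<forall>t. (\<forall>i<k. K t \<notin> ball (K (real i)) r) \<longrightarrow> L t = K t"
    and "\<forall>i<k. \<exists>a b w. P r i a b w"
    by (elim exE conjE) (rule that)
  hence "\<forall>i. \<exists>a b w. i < k \<longrightarrow> P r i a b w" by blast
  then obtain a b w where P: "\<And>i. i < k \<Longrightarrow> P r i (a i) (b i) (w i)" by metis
  have abw: "real i - 1 < a i \<and> a i < real i \<and> real i < b i \<and> b i < real i + 1 \<and> w i $ 3 = 0" if "i < k" for i
    using P[OF that] unfolding P_def by (elim conjE) (intro conjI)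
  have K_ball: "K t \<in> ball (K (real i)) r \<longleftrightarrow> t \<in> {a i<..<b i}"
    if "i < k" "t \<in> {real i - real k / 2..real i + real k / 2}" for i t
    using P[OF that(1)] that(2) unfolding P_def by (elim conjE) (rule bspec)
  have in_arc: "L t \<in> ball (K (real i)) r \<and> 0 < w i \<bullet> L' t \<and> (t \<noteq> real i \<longrightarrow> 0 < w i \<bullet> vector_derivative K (at t))"
    if "i < k" "t \<in> {a i<..<b i}" for i t
    using P[OF that(1)] that(2) unfolding P_def vdL by (elim conjE) (rule bspec)
  \<comment> \<open>\<open>ind i\<close> is the residue of \<open>i\<close> modulo \<open>k\<close>,
    and \<open>off i\<close> is the length of the whole periods removed from it.\<close>
  define ind where "ind = (\<lambda>i::int. nat (i mod int k))"
  define off where "off = (\<lambda>i::int. real_of_int (i div int k) * real k)"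
  have ind: "ind i < k" for i by (simp add: ind_def ix)
  have split: "of_int i = real (ind i) + off i" for i
  proof -
    have "i = int (ind i) + (i div int k) * int k" using k0 by (simp add: ind_def)
    hence "real_of_int i = real_of_int (int (ind i) + (i div int k) * int k)" by simp
    thus ?thesis by (simp add: off_def)
  qed
  have shift: "f (t + off i) = f t" if "\<And>t. f (t + real k) = f t" for f :: "real \<Rightarrow> real^3" and t i
    unfolding off_def by (rule periodic_int_shift) (rule that)
  have K_int: "K (of_int i) = K (real (ind i))" for i unfolding split by (rule shift) (rule K_period)
  have "rounded_curve k K K' K'' L L' L'' r (\<lambda>i. a (ind i) + off i) (\<lambda>i. b (ind i) + off i) (\<lambda>i. w (ind i))"
  proof
    show "2 \<le> k" using k3 by simp
    show "ball (K (of_int i)) r \<inter> ball (K (of_int j)) r = {}" if "i mod int k \<noteq> j mod int k" for i j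
    proof -
      have "ind i \<noteq> ind j" using that k0 by (simp add: ind_def nat_eq_iff)
      thus ?thesis unfolding K_int using balls ind by blast
    qed
    show "L t = K t" if h: "\<And>i::int. K t \<notin> ball (K (of_int i)) r" for t
    proof (rule outside[rule_format])
      fix i assume "i < k"
      show "K t \<notin> ball (K (real i)) r" using h[of "int i"] by simp
    qed
    fix i :: int
    show "of_int i - 1 < a (ind i) + off i \<and> a (ind i) + off i < of_int i \<and>
        of_int i < b (ind i) + off i \<and> b (ind i) + off i < of_int i + 1"
      using abw[OF ind[of i]] unfolding split[of i] by auto
    show "w (ind i) $ 3 = 0" using abw[OF ind[of i]] by simp
    show "K t \<in> ball (K (of_int i)) r \<longleftrightarrow> t \<in> {a (ind i) + off i<..<b (ind i) + off i}"
      if "t \<in> {of_int i - real k / 2..of_int i + real k / 2}" for t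
    proof -
      have "K t = K (t - off i)" using shift[of K "t - off i" i, OF K_period] by simp
      moreover have "t - off i \<in> {real (ind i) - real k / 2..real (ind i) + real k / 2}"
        using that unfolding split[of i] by auto
      ultimately show ?thesis using K_ball[OF ind, of "t - off i" i] unfolding K_int by auto
    qed
    fix t assume t: "t \<in> {a (ind i) + off i<..<b (ind i) + off i}"
    hence t': "t - off i \<in> {a (ind i)<..<b (ind i)}" by auto
    have eqs: "L (t - off i) = L t" "L' (t - off i) = L' t" "K' (t - off i) = K' t"
      using shift[of L "t - off i" i, OF L_period] shift[of L' "t - off i" i, OF L'_period]
        shift[of K' "t - off i" i, OF K'_period] by simp_all
    show "L t \<in> ball (K (of_int i)) r" "0 < w (ind i) \<bullet> L' t"
      using in_arc[OF ind t'] unfolding K_int eqs by auto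
    show "0 < w (ind i) \<bullet> K' t" if "t \<noteq> of_int i"
    proof -
      have ne: "t - off i \<noteq> real (ind i)" using that unfolding split[of i] by auto
      \<comment> \<open>Strictly between the neighbouring integers and different from the corner,
        the parameter is not an integer, so \<open>K'\<close> is the derivative of \<open>K\<close>
        there.\<close>
      have "t - off i \<notin> \<int>"
      proof
        assume "t - off i \<in> \<int>"
        then obtain n :: int where n: "t - off i = of_int n" by (auto elim: Ints_cases)
        have "real (ind i) - 1 < of_int n" "of_int n < real (ind i) + 1"
          using t' abw[OF ind[of i]] unfolding n by auto
        hence "n = int (ind i)" by linarith
        thus False using ne n by simp
      qed
      hence "vector_derivative K (at (t - off i)) = K' t"
        using K' eqs(3) by (metis vector_derivative_at)
      thus ?thesis using in_arc[OF ind t'] ne by simp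
    qed
  qed (use K_period K_inj K_cont K' K'' K_leg L_period L' L'' L'_leg r in auto)
  thus ?thesis unfolding k_def K_def by blast
qed

text \<open>The form on pairs of edges, normalised like the linking integral. For a single pair it
  varies with \<epsilon>; a topological meaning arises only in the sum over closed cycles.\<close>

definition edge_gauss :: "('v \<Rightarrow> 'v \<Rightarrow> real \<Rightarrow> real^3) \<Rightarrow> real \<Rightarrow> 'v \<times> 'v \<Rightarrow> 'v \<times> 'v \<Rightarrow> real" where
  "edge_gauss e \<epsilon> = (\<lambda>(a, b) (c, d). 1 / (4 * pi) * gauss_integral
     (e a b) (\<lambda>t. vector_derivative (e a b) (at t within {0..1}))
     (\<lambda>t. e c d t + \<epsilon> *\<^sub>R axis 3 1) (\<lambda>t. vector_derivative (e c d) (at t within {0..1})))"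

lemma vector_derivative_reverse:
  fixes g h :: "real \<Rightarrow> real^3"
  assumes g: "C1_arc g g'" and h: "\<And>t. t \<in> {0..1} \<Longrightarrow> h t = g (1 - t)" and t: "t \<in> {0..1}"
  shows "vector_derivative h (at t within {0..1}) = - g' (1 - t)"
proof (rule vector_derivative_within_closed_interval)
  have "((\<lambda>t. 1 - t) has_vector_derivative -1) (at t within {0..1})"
    by (auto intro!: derivative_eq_intros)
  moreover have "(\<lambda>t. 1 - t) ` {0..1} = {0..1::real}" by (force simp: image_iff intro: bexI[of _ "1 - _"])
  hence "(g has_vector_derivative g' (1 - t)) (at (1 - t) within (\<lambda>t. 1 - t) ` {0..1})"
    using g t by (simp add: C1_arc_def)
  ultimately have "(g \<circ> (\<lambda>t. 1 - t) has_vector_derivative (-1) *\<^sub>R g' (1 - t)) (at t within {0..1})"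
    by (rule vector_diff_chain_within)
  hence "(g \<circ> (\<lambda>t. 1 - t) has_vector_derivative - g' (1 - t)) (at t within {0..1})" by simp
  thus "(h has_vector_derivative - g' (1 - t)) (at t within {0..1})"
    by (rule has_vector_derivative_transform_within[of _ _ _ _ 1]) (use t h in auto)
qed (use t in auto)

lemma edge_gauss_swap:
  assumes emb: "legendrian_embedding V E p e" and c: "dart_edge c \<in> E" and d: "dart_edge d \<in> E"
  shows "edge_gauss e \<epsilon> (prod.swap c) d = - edge_gauss e \<epsilon> c d"
    "edge_gauss e \<epsilon> c (prod.swap d) = - edge_gauss e \<epsilon> c d"
proof -
  obtain x y where xy: "c = (x, y)" "{x, y} \<in> E" using c by (cases c) auto
  obtain z w where zw: "d = (z, w)" "{z, w} \<in> E" using d by (cases d) auto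
  let ?e' = "\<lambda>a b t. vector_derivative (e a b) (at t within {0..1})"
  have rev: "e b a t = e a b (1 - t)" "?e' b a t = - ?e' a b (1 - t)" if "{a, b} \<in> E" "t \<in> {0..1}" for a b t
  proof -
    note D = legendrian_embeddingD[OF emb]
    show "e b a t = e a b (1 - t)" by (rule D(4)[OF that])
    show "?e' b a t = - ?e' a b (1 - t)"
      using D(5)[OF that(1)] D(4)[OF that(1)] that(2)
      by (intro vector_derivative_reverse[of "e a b"] smooth_C1_arc) (auto simp: legendrian_curve_on_def)
  qed
  have "gauss_integral (e y x) (?e' y x) (\<lambda>t. e z w t + \<epsilon> *\<^sub>R axis 3 1) (?e' z w) =
      gauss_integral (\<lambda>t. e x y (1 - t)) (\<lambda>t. - ?e' x y (1 - t)) (\<lambda>t. e z w t + \<epsilon> *\<^sub>R axis 3 1) (?e' z w)"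
    by (rule gauss_integral_cong) (use rev[OF xy(2)] in auto)
  also have "\<dots> = - gauss_integral (e x y) (?e' x y) (\<lambda>t. e z w t + \<epsilon> *\<^sub>R axis 3 1) (?e' z w)"
    by (rule gauss_integral_reverse(1)[of "e x y" "?e' x y"])
  finally show "edge_gauss e \<epsilon> (prod.swap c) d = - edge_gauss e \<epsilon> c d"
    by (simp add: edge_gauss_def xy(1) zw(1))
  have "gauss_integral (e x y) (?e' x y) (\<lambda>t. e w z t + \<epsilon> *\<^sub>R axis 3 1) (?e' w z) =
      gauss_integral (e x y) (?e' x y) (\<lambda>t. (\<lambda>t. e z w t + \<epsilon> *\<^sub>R axis 3 1) (1 - t)) (\<lambda>t. - ?e' z w (1 - t))"
    by (rule gauss_integral_cong) (use rev[OF zw(2)] in auto)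
  also have "\<dots> = - gauss_integral (e x y) (?e' x y) (\<lambda>t. e z w t + \<epsilon> *\<^sub>R axis 3 1) (?e' z w)"
    by (rule gauss_integral_reverse(2)[of "e x y" "?e' x y" "\<lambda>t. e z w t + \<epsilon> *\<^sub>R axis 3 1" "?e' z w"])
  finally show "edge_gauss e \<epsilon> c (prod.swap d) = - edge_gauss e \<epsilon> c d"
    by (simp add: edge_gauss_def xy(1) zw(1))
qed

text \<open>The cycle pushed off by \<epsilon> and the smoothing pushed off by another \<epsilon>'
  are joined in one homotopy. Both heights lie below the bound on vertical chords, so the linking
  number of the smoothing is the same for all small \<epsilon>' and equals the form at
  \<epsilon>.\<close>

lemma tb_smoothing:
  assumes emb: "legendrian_embedding UNIV E p e" and tr: "traces_cycle E vs \<gamma>"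
    and sm: "legendrian_smoothing (length vs) (cycle_curve e vs) L"
  shows "\<exists>\<epsilon>\<^sub>0>0. \<forall>\<epsilon>. 0 < \<epsilon> \<longrightarrow> \<epsilon> < \<epsilon>\<^sub>0 \<longrightarrow> tb (length vs) L = dart_sum (edge_gauss e \<epsilon>) vs"
proof -
  define k where "k = length vs"
  define K where "K = cycle_curve e vs"
  obtain K' K'' L' L'' r a b w where "rounded_curve k K K' K'' L L' L'' r a b w"
    using smoothing_rounded_curve[OF emb tr sm] unfolding k_def K_def by blast
  then interpret rounded_curve k K K' K'' L L' L'' r a b w .
  obtain \<epsilon>\<^sub>0 where e0: "0 < \<epsilon>\<^sub>0"
    and chord: "\<And>\<epsilon> s t u. 0 < \<epsilon> \<Longrightarrow> \<epsilon> < \<epsilon>\<^sub>0 \<Longrightarrow> s \<in> {0..1} \<Longrightarrow> C s t \<noteq> C s u + \<epsilon> *\<^sub>R axis 3 1"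
    using no_short_vertical_chords by blast
  have k0: "0 < k" and dist: "distinct vs" using tr by (auto simp: traces_cycle_def k_def)
  define c where "c = (\<lambda>i. e (vs ! i) (vs ! (Suc i mod k)))"
  define c' where "c' = (\<lambda>i t. vector_derivative (c i) (at t within {0..1}))"
  have edge: "{vs ! i, vs ! (Suc i mod k)} \<in> E" if "i < k" for i
    using tr that unfolding traces_cycle_def k_def by blast
  note D = legendrian_embeddingD[OF emb]
  have c_arc: "C1_arc (c i) (c' i)" if "i < k" for i
    using D(5)[OF edge[OF that]] unfolding c_def c'_def legendrian_curve_on_def by (intro smooth_C1_arc) simp
  have closed: "c i 1 = c (Suc i mod k) 0" if "i < k" for i
    using D(3)[OF edge[OF that]] D(2)[OF edge[of "Suc i mod k"]] k0 by (simp add: c_def)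
  have Kc: "K (real i + t) = c i t" if "i < k" "t \<in> {0..1}" for i t
    using loop_closed_piece[where c = c and n = "int i" and t = t, OF k0 closed that(2)] that(1)
    by (simp add: K_def cycle_curve_eq_loop c_def k_def)
  have L'_cont: "continuous_on UNIV L'"
    using L'' by (auto intro!: continuous_at_imp_continuous_on has_vector_derivative_continuous)
  have L_arc: "C1_arc (\<lambda>t. L (x + t)) (\<lambda>t. L' (x + t))" for x
    unfolding C1_arc_def
  proof (intro conjI ballI)
    show "continuous_on {0..1} (\<lambda>t. L' (x + t))"
      by (rule continuous_on_compose2[OF L'_cont]) (auto intro!: continuous_intros)
    fix t :: real
    have "((\<lambda>t. x + t) has_vector_derivative 1) (at t)" by (auto intro!: derivative_eq_intros)
    hence "(L \<circ> (\<lambda>t. x + t) has_vector_derivative 1 *\<^sub>R L' (x + t)) (at t)"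
      using L' by (rule vector_diff_chain_at)
    thus "((\<lambda>t. L (x + t)) has_vector_derivative L' (x + t)) (at t within {0..1})"
      by (simp add: comp_def has_vector_derivative_at_within)
  qed
  have L_closed: "L (real i + 1) = L (real (Suc i mod k) + 0)" if "i < k" for i
  proof (cases "Suc i = k")
    case True
    hence "real i + 1 = 0 + real k" by (simp flip: True)
    hence "L (real i + 1) = L 0" using L_period[of 0] by metis
    thus ?thesis using True by simp
  qed (use that in \<open>simp add: add.commute\<close>)
  have arc_add: "C1_arc (\<lambda>t. g t + v) g'" if "C1_arc g g'" for g g' v
    using that unfolding C1_arc_def by (auto simp: has_vector_derivative_add_const)
  have lk: "linking_number k L (\<lambda>t. L t + \<epsilon>' *\<^sub>R axis 3 1) = dart_sum (edge_gauss e \<epsilon>) vs"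
    if \<epsilon>: "0 < \<epsilon>" "\<epsilon> < \<epsilon>\<^sub>0" and \<epsilon>': "0 < \<epsilon>'" "\<epsilon>' < \<epsilon>\<^sub>0" for \<epsilon> \<epsilon>'
  proof -
    have "linking_number k L (\<lambda>t. L t + \<epsilon>' *\<^sub>R axis 3 1) = 1 / (4 * pi) * (\<Sum>i<k. \<Sum>j<k.
      gauss_integral (\<lambda>t. L (real i + t)) (\<lambda>t. L' (real i + t))
        (\<lambda>u. L (real j + u) + \<epsilon>' *\<^sub>R axis 3 1) (\<lambda>u. L' (real j + u)))"
    proof (rule linking_number_pieces[OF L' L'_cont _ L'_cont])
      show "((\<lambda>t. L t + \<epsilon>' *\<^sub>R axis 3 1) has_vector_derivative L' t) (at t)" for t
        using L' by (simp add: has_vector_derivative_add_const)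
      show "L t \<noteq> L u + \<epsilon>' *\<^sub>R axis 3 1" for t u
        using chord[OF \<epsilon>', of 1 t u] by (simp add: C_def)
    qed
    also have "(\<Sum>i<k. \<Sum>j<k. gauss_integral (\<lambda>t. L (real i + t)) (\<lambda>t. L' (real i + t))
        (\<lambda>u. L (real j + u) + \<epsilon>' *\<^sub>R axis 3 1) (\<lambda>u. L' (real j + u))) =
      (\<Sum>i<k. \<Sum>j<k. gauss_integral (c i) (c' i) (\<lambda>u. c j u + \<epsilon> *\<^sub>R axis 3 1) (c' j))"
    proof (rule gauss_integral_homotopy[symmetric, OF k0])
      fix i j and s t u :: real
      assume h: "i < k" "j < k" "s \<in> {0..1}" "t \<in> {0..1}" "u \<in> {0..1}"
      \<comment> \<open>The height of the push-off at stage \<open>s\<close> is a convex combination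
        of two values between 0 and \<open>\<epsilon>\<^sub>0\<close>, hence again a forbidden chord
        length.\<close>
      define \<delta> where "\<delta> = (1 - s) * \<epsilon> + s * \<epsilon>'"
      have "0 < \<delta>" "\<delta> < \<epsilon>\<^sub>0"
        unfolding \<delta>_def using \<epsilon> \<epsilon>' h(3) convex_bound_lt[of \<epsilon> \<epsilon>\<^sub>0 \<epsilon>' "1 - s" s]
          convex_bound_lt[of "- \<epsilon>" 0 "- \<epsilon>'" "1 - s" s] by simp_all
      hence "C s (real i + t) \<noteq> C s (real j + u) + \<delta> *\<^sub>R axis 3 1" using h(3) by (rule chord)
      thus "(1 - s) *\<^sub>R c i t + s *\<^sub>R L (real i + t) \<noteq>
          (1 - s) *\<^sub>R (c j u + \<epsilon> *\<^sub>R axis 3 1) + s *\<^sub>R (L (real j + u) + \<epsilon>' *\<^sub>R axis 3 1)"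
        unfolding C_def Kc[OF h(1,4)] Kc[OF h(2,5)] \<delta>_def by (simp add: algebra_simps)
    qed (use closed L_closed in \<open>auto intro: c_arc L_arc arc_add\<close>)
    also have "1 / (4 * pi) * \<dots> = dart_sum (edge_gauss e \<epsilon>) vs"
      by (simp add: dart_sum_conv_nth[OF dist] edge_gauss_def c_def c'_def k_def sum_distrib_left)
    finally show ?thesis .
  qed
  have "tb k L = dart_sum (edge_gauss e \<epsilon>) vs" if \<epsilon>: "0 < \<epsilon>" "\<epsilon> < \<epsilon>\<^sub>0" for \<epsilon>
    unfolding tb_def
  proof (rule the_equality)
    have ev: "\<forall>\<^sub>F \<epsilon>' in at_right 0. \<epsilon>' \<in> {0<..<\<epsilon>\<^sub>0}" by (rule eventually_at_right_real[OF e0])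
    show *: "\<forall>\<^sub>F \<epsilon>' in at_right 0. linking_number k L (\<lambda>t. L t + \<epsilon>' *\<^sub>R axis 3 1) = dart_sum (edge_gauss e \<epsilon>) vs"
      using ev by (rule eventually_mono) (use lk \<epsilon> in auto)
    fix x assume "\<forall>\<^sub>F \<epsilon>' in at_right 0. linking_number k L (\<lambda>t. L t + \<epsilon>' *\<^sub>R axis 3 1) = x"
    with * have "\<forall>\<^sub>F \<epsilon>' in at_right (0::real). x = dart_sum (edge_gauss e \<epsilon>) vs"
      by eventually_elim simp
    thus "x = dart_sum (edge_gauss e \<epsilon>) vs" by simp
  qed
  thus ?thesis using e0 unfolding k_def by blast
qed

theorem theorem1p19:
  fixes p :: "petersen_vertex \<Rightarrow> real^3"
    and e :: "petersen_vertex \<Rightarrow> petersen_vertex \<Rightarrow> real \<Rightarrow> real^3"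
    and S :: "petersen_vertex set set \<Rightarrow> real \<Rightarrow> real^3"
  assumes "legendrian_embedding UNIV petersen_edges p e"
    and "\<And>\<gamma>. \<gamma> \<in> cycles petersen_edges \<Longrightarrow> smoothing_of_cycle petersen_edges e \<gamma> (S \<gamma>)"
  shows "TB 6 petersen_edges S = TB 5 petersen_edges S \<and>
         TB 8 petersen_edges S = 2 * TB 5 petersen_edges S \<and>
         TB 9 petersen_edges S = 3 * TB 5 petersen_edges S \<and>
         TB_total petersen_edges S = 7 * TB 5 petersen_edges S"
proof -
  have "\<forall>\<gamma>\<in>cycles petersen_edges. \<forall>\<^sub>F \<epsilon> in at_right 0.
      \<exists>vs. traces_cycle petersen_edges vs \<gamma> \<and> tb (card \<gamma>) (S \<gamma>) = dart_sum (edge_gauss e \<epsilon>) vs"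
  proof
    fix \<gamma> assume "\<gamma> \<in> cycles petersen_edges"
    then obtain vs where vs: "traces_cycle petersen_edges vs \<gamma>"
      "legendrian_smoothing (length vs) (cycle_curve e vs) (S \<gamma>)"
      using assms(2) unfolding smoothing_of_cycle_def by blast
    obtain \<epsilon>\<^sub>0 where "0 < \<epsilon>\<^sub>0"
      "\<And>\<epsilon>. 0 < \<epsilon> \<Longrightarrow> \<epsilon> < \<epsilon>\<^sub>0 \<Longrightarrow> tb (length vs) (S \<gamma>) = dart_sum (edge_gauss e \<epsilon>) vs"
      using tb_smoothing[OF assms(1) vs] by blast
    thus "\<forall>\<^sub>F \<epsilon> in at_right 0. \<exists>vs. traces_cycle petersen_edges vs \<gamma> \<and>
        tb (card \<gamma>) (S \<gamma>) = dart_sum (edge_gauss e \<epsilon>) vs"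
      using vs(1) card_traces_cycle[OF vs(1)] eventually_at_right_real[of 0 \<epsilon>\<^sub>0]
      by (auto elim!: eventually_mono)
  qed
  \<comment> \<open>The bound on \<epsilon> depends on the cycle, but all cycles must be evaluated
    with the same form; finiteness yields a common \<epsilon>.\<close>
  moreover have "finite (cycles petersen_edges)"
    by (rule finite_petersen_cycles)
  ultimately have "\<forall>\<^sub>F \<epsilon> in at_right (0::real). \<forall>\<gamma>\<in>cycles petersen_edges.
      \<exists>vs. traces_cycle petersen_edges vs \<gamma> \<and> tb (card \<gamma>) (S \<gamma>) = dart_sum (edge_gauss e \<epsilon>) vs"
    by (simp add: eventually_ball_finite)
  then obtain \<epsilon> where \<epsilon>: "\<And>\<gamma>. \<gamma> \<in> cycles petersen_edges \<Longrightarrow>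
      \<exists>vs. traces_cycle petersen_edges vs \<gamma> \<and> tb (card \<gamma>) (S \<gamma>) = dart_sum (edge_gauss e \<epsilon>) vs"
    using eventually_happens'[OF trivial_limit_at_right_real] by blast
  show ?thesis
    unfolding TB_def TB_total_def
    using petersen_cycle_sums[where F = "\<lambda>\<gamma>. tb (card \<gamma>) (S \<gamma>)" and G = "edge_gauss e \<epsilon>",
        OF \<epsilon> edge_gauss_swap[OF assms(1)]]
    by blast
qed

end
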